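(* Let $1<p<\infty$ and let $X=(X,d,\mu)$ be a connected metric measure space such that $\mu$ is locally doubling and supports a local $p$-Poincaré inequality. Let $\Omega\subset X$ be open. If $u$ is quasiharmonic in $\Omega$ and $G\in\mathcal{G}_{\rm dist}(\Omega)$ with $\emptyset\ne G\ne X$, then $$\sup_Gu=\sup_{\partial G}u.$$
   Context: Throughout, $1<p<\infty$ and $X=(X,d,\mu)$ is a metric space with a positive complete Borel measure $\mu$ such that $0<\mu(B)<\infty$ for all balls $B\subset X$. $X$ need not be complete or locally compact. Balls are open and come with a prescribed centre and radius $r_B$; $\lambda B$ is the concentric ball with radius $\lambda r_B$. Upper gradients. Curves are nonconstant, compact and rectifiable, parameterized by arc length $ds$. A property holds for $p$-almost every curve if for the family $\Gamma$ of curves for which it fails there is a Borel function $0\le\rho\in L^p(X)$ with $\int_\gamma\rho\,ds=\infty$ for all $\gamma\in\Gamma$. A measurable $g:X\to[0,\infty]$ is a $p$-weak upper gradient of $u:X\to[-\infty,\infty]$ if for $p$-almost every curve $\gamma:[0,l_\gamma]\to X$, $|u(\gamma(0))-u(\gamma(l_\gamma))|\le\int_\gamma g\,ds$ (left-hand side $\infty$ if a term is $\pm\infty$). If $u$ has a $p$-weak upper gradient in $L^p_{\rm loc}$, then $g_u$ denotes the minimal one (a.e. smallest). For measurable $u$, $\|u\|_{N^{1,p}(X)}^p=\int_X|u|^p\,d\mu+\inf_g\int_Xg^p\,d\mu$, infimum over $p$-weak upper gradients $g$ of $u$, and $N^{1,p}(X)=\{u:\|u\|_{N^{1,p}(X)}<\infty\}$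 (functions defined everywhere); $N^{1,p}(E)$ is defined by regarding a measurable set $E$ as a metric measure space in its own right. Local assumptions. $\mu$ is locally doubling if for every $x_0\in X$ there are $r_0>0$, $C>0$ (depending on $x_0$) with $\mu(2B)\le C\mu(B)$ for all balls $B\subset B(x_0,r_0)$. $\mu$ supports a local $p$-Poincaré inequality if for every $x_0\in X$ there are $r_0>0$, $C>0$, $\lambda\ge1$ (depending on $x_0$) such that for all balls $B\subset B(x_0,r_0)$, all integrable $u$ on $\lambda B$ and all $p$-weak upper gradients $g$ of $u$, $\frac1{\mu(B)}\int_B|u-u_B|\,d\mu\le Cr_B\bigl(\frac1{\mu(\lambda B)}\int_{\lambda B}g^p\,d\mu\bigr)^{1/p}$, where $u_B=\frac1{\mu(B)}\int_Bu\,d\mu$. Quasiharmonic functions. For open $\Omega\subset X$, let $\mathcal{G}_{\rm dist}(\Omega)$ be the collection of bounded open $G\subset\Omega$ with $\operatorname{dist}(G,X\setminus\Omega)>0$ (by convention $\operatorname{dist}(G,\emptyset)>0$). Let $N^{1,p}_0(G)$ be the restrictions to $G$ of $\varphi\in N^{1,p}(X)$ with $\varphi=0$ in $X\setminus G$ (identified with their zero extensions). $N^{1,p}_{\rm loc,dist}(\Omega)$ is the set of $u:\Omega\to[-\infty,\infty]$ with $u\in N^{1,p}(G)$ for all $G\in\mathcal{G}_{\rm dist}(\Omega)$, and $N^{1,p}_{0,\rm dist}(\Omega)$ is the closure, in the $N^{1,p}(X)$-norm, of the set of functions belonging to $N^{1,p}_0(G)$ for some $G\in\mathcal{G}_{\rm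 dist}(\Omega)$. A function $u\in N^{1,p}_{\rm loc,dist}(\Omega)$ is a quasiminimizer in $\Omega$ if there is $Q\ge1$ with $\int_{\{\varphi\ne0\}}g_u^p\,d\mu\le Q\int_{\{\varphi\ne0\}}g_{u+\varphi}^p\,d\mu$ for all $\varphi\in N^{1,p}_{0,\rm dist}(\Omega)$. A continuous (real-valued) quasiminimizer is called quasiharmonic. *)

theory Defs
  imports "HOL-Analysis.Analysis"
begin

text \<open>
  The metric space \<open>X\<close> is the type \<open>'a::metric_space\<close>.  A measurable set \<open>E\<close> is regarded as a metric
  measure space in its own right by letting curves run inside \<open>E\<close> and restricting the measure to \<open>E\<close>;
  the definitions below carry \<open>E\<close> as a parameter, and \<open>E = UNIV\<close> gives the notions for \<open>X\<close>.
  Functions on \<open>E\<close> are total functions whose values outside \<open>E\<close> are never used.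
\<close>

definition ennpowr :: "ennreal \<Rightarrow> real \<Rightarrow> ennreal" where
  "ennpowr x a = (if x = \<infinity> then \<infinity> else ennreal (enn2real x powr a))"

text \<open>
  A complete Borel measure is taken to live on the completion of the Borel sigma-algebra (as for
  \<^const>\<open>lebesgue\<close>); this is what makes line integrals of measurable functions well defined along
  \<open>p\<close>-almost every curve.
\<close>

definition metric_measure_space :: "'a::metric_space measure \<Rightarrow> bool" where
  "metric_measure_space \<mu> \<longleftrightarrow>
     (\<exists>\<nu>. sets \<nu> = sets borel \<and> \<mu> = completion \<nu>) \<and>
     (\<forall>x r. 0 < r \<longrightarrow> 0 < emeasure \<mu> (ball x r) \<and> emeasure \<mu> (ball x r) < \<infinity>)"

definition curve_length :: "(real \<Rightarrow> 'a::metric_space) \<Rightarrow> real \<Rightarrow> real \<Rightarrow> ennreal" where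
  "curve_length \<gamma> a b =
     (SUP (n, t) \<in> {(n :: nat, t :: nat \<Rightarrow> real). mono_on {..n} t \<and> t 0 = a \<and> t n = b}.
        \<Sum>i<n. ennreal (dist (\<gamma> (t i)) (\<gamma> (t (Suc i)))))"

text \<open>
  The length condition expresses that \<open>\<gamma> : [0,l] \<rightarrow> E\<close> is rectifiable and parameterized by arc length,
  and \<open>0 < l\<close> that it is not constant.
\<close>

definition arc_curve :: "'a::metric_space set \<Rightarrow> (real \<Rightarrow> 'a) \<Rightarrow> real \<Rightarrow> bool" where
  "arc_curve E \<gamma> l \<longleftrightarrow> 0 < l \<and> continuous_on {0..l} \<gamma> \<and> \<gamma> ` {0..l} \<subseteq> E \<and>
     (\<forall>s t. 0 \<le> s \<and> s \<le> t \<and> t \<le> l \<longrightarrow> curve_length \<gamma> s t = ennreal (t - s))"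

definition curve_integral :: "(real \<Rightarrow> 'a) \<Rightarrow> real \<Rightarrow> ('a \<Rightarrow> ennreal) \<Rightarrow> ennreal" where
  "curve_integral \<gamma> l g = (\<integral>\<^sup>+t\<in>{0..l}. g (\<gamma> t) \<partial>lebesgue)"

definition ae_curve ::
  "real \<Rightarrow> 'a::metric_space measure \<Rightarrow> 'a set \<Rightarrow> ((real \<Rightarrow> 'a) \<Rightarrow> real \<Rightarrow> bool) \<Rightarrow> bool" where
  "ae_curve p \<mu> E P \<longleftrightarrow>
     (\<exists>\<rho>. \<rho> \<in> borel_measurable (restrict_space borel E) \<and>
          (\<integral>\<^sup>+x\<in>E. ennpowr (\<rho> x) p \<partial>\<mu>) < \<infinity> \<and>
          (\<forall>\<gamma> l. arc_curve E \<gamma> l \<and> \<not> P \<gamma> l \<longrightarrow> curve_integral \<gamma> l \<rho> = \<infinity>))"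

definition ediff :: "ereal \<Rightarrow> ereal \<Rightarrow> ennreal" where
  "ediff a b = (if \<bar>a\<bar> = \<infinity> \<or> \<bar>b\<bar> = \<infinity> then \<infinity> else e2ennreal \<bar>a - b\<bar>)"

definition weak_upper_gradient ::
  "real \<Rightarrow> 'a::metric_space measure \<Rightarrow> 'a set \<Rightarrow> ('a \<Rightarrow> ereal) \<Rightarrow> ('a \<Rightarrow> ennreal) \<Rightarrow> bool" where
  "weak_upper_gradient p \<mu> E u g \<longleftrightarrow>
     g \<in> borel_measurable (restrict_space \<mu> E) \<and>
     ae_curve p \<mu> E (\<lambda>\<gamma> l. ediff (u (\<gamma> 0)) (u (\<gamma> l)) \<le> curve_integral \<gamma> l g)"

text \<open>Local integrability means integrability in a neighbourhood of every point of \<open>E\<close>.\<close>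

definition in_Lp_loc ::
  "real \<Rightarrow> 'a::metric_space measure \<Rightarrow> 'a set \<Rightarrow> ('a \<Rightarrow> ennreal) \<Rightarrow> bool" where
  "in_Lp_loc p \<mu> E g \<longleftrightarrow> g \<in> borel_measurable (restrict_space \<mu> E) \<and>
     (\<forall>x\<in>E. \<exists>r>0. (\<integral>\<^sup>+y\<in>E \<inter> ball x r. ennpowr (g y) p \<partial>\<mu>) < \<infinity>)"

definition is_minimal_wug ::
  "real \<Rightarrow> 'a::metric_space measure \<Rightarrow> 'a set \<Rightarrow> ('a \<Rightarrow> ereal) \<Rightarrow> ('a \<Rightarrow> ennreal) \<Rightarrow> bool" where
  "is_minimal_wug p \<mu> E u g \<longleftrightarrow>
     weak_upper_gradient p \<mu> E u g \<and> in_Lp_loc p \<mu> E g \<and>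
     (\<forall>h. weak_upper_gradient p \<mu> E u h \<and> in_Lp_loc p \<mu> E h \<longrightarrow> (AE x in \<mu>. x \<in> E \<longrightarrow> g x \<le> h x))"

text \<open>
  The minimal \<open>p\<close>-weak upper gradient \<open>g\<^sub>u\<close> of \<open>u\<close> in \<open>E\<close>.  It is unique up to null sets, so the choice
  does not affect integrals; it is meaningful when \<open>u\<close> has a \<open>p\<close>-weak upper gradient in \<open>L\<^sup>p\<^sub>l\<^sub>o\<^sub>c(E)\<close>.
\<close>

definition minimal_wug ::
  "real \<Rightarrow> 'a::metric_space measure \<Rightarrow> 'a set \<Rightarrow> ('a \<Rightarrow> ereal) \<Rightarrow> 'a \<Rightarrow> ennreal" where
  "minimal_wug p \<mu> E u = (SOME g. is_minimal_wug p \<mu> E u g)"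

definition N1p_norm_pow ::
  "real \<Rightarrow> 'a::metric_space measure \<Rightarrow> 'a set \<Rightarrow> ('a \<Rightarrow> ereal) \<Rightarrow> ennreal" where
  "N1p_norm_pow p \<mu> E u =
     (\<integral>\<^sup>+x\<in>E. ennpowr (e2ennreal \<bar>u x\<bar>) p \<partial>\<mu>) +
     (INF g \<in> {g. weak_upper_gradient p \<mu> E u g}. \<integral>\<^sup>+x\<in>E. ennpowr (g x) p \<partial>\<mu>)"

definition N1p :: "real \<Rightarrow> 'a::metric_space measure \<Rightarrow> 'a set \<Rightarrow> ('a \<Rightarrow> ereal) set" where
  "N1p p \<mu> E = {u. u \<in> borel_measurable (restrict_space \<mu> E) \<and> N1p_norm_pow p \<mu> E u < \<infinity>}"

text \<open>Elements of \<open>N\<^sup>1\<^sup>,\<^sup>p\<^sub>0(G)\<close> are represented by their zero extensions.\<close>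

definition N1p_zero :: "real \<Rightarrow> 'a::metric_space measure \<Rightarrow> 'a set \<Rightarrow> ('a \<Rightarrow> ereal) set" where
  "N1p_zero p \<mu> G = {\<phi> \<in> N1p p \<mu> UNIV. \<forall>x. x \<notin> G \<longrightarrow> \<phi> x = 0}"

text \<open>
  \<open>dist(G, X \<setminus> \<Omega>) > 0\<close>; the empty set is treated separately because \<^const>\<open>setdist\<close> to or from the
  empty set is \<open>0\<close>.
\<close>

definition G_dist :: "'a::metric_space set \<Rightarrow> 'a set set" where
  "G_dist \<Omega> = {G. bounded G \<and> open G \<and> G \<subseteq> \<Omega> \<and> (G = {} \<or> - \<Omega> = {} \<or> 0 < setdist G (- \<Omega>))}"

definition N1p_loc_dist :: "real \<Rightarrow> 'a::metric_space measure \<Rightarrow> 'a set \<Rightarrow> ('a \<Rightarrow> ereal) set" where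
  "N1p_loc_dist p \<mu> \<Omega> = {u. \<forall>G\<in>G_dist \<Omega>. u \<in> N1p p \<mu> G}"

text \<open>
  Functions in \<open>N\<^sup>1\<^sup>,\<^sup>p\<close> are finite outside a set met by \<open>p\<close>-almost no curve, so the value that
  \<^typ>\<open>ereal\<close> assigns to \<open>\<infinity> - \<infinity>\<close> in \<open>\<phi> - \<psi>\<close> (and, below, in \<open>u + \<phi>\<close>) is immaterial.
\<close>

definition N1p_zero_dist :: "real \<Rightarrow> 'a::metric_space measure \<Rightarrow> 'a set \<Rightarrow> ('a \<Rightarrow> ereal) set" where
  "N1p_zero_dist p \<mu> \<Omega> =
     {\<phi> \<in> N1p p \<mu> UNIV. \<forall>\<epsilon>>0. \<exists>G\<in>G_dist \<Omega>. \<exists>\<psi>\<in>N1p_zero p \<mu> G.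
        ennpowr (N1p_norm_pow p \<mu> UNIV (\<lambda>x. \<phi> x - \<psi> x)) (1 / p) < ennreal \<epsilon>}"

definition locally_doubling :: "'a::metric_space measure \<Rightarrow> bool" where
  "locally_doubling \<mu> \<longleftrightarrow>
     (\<forall>x0. \<exists>r0>0. \<exists>C>0. \<forall>x r. 0 < r \<and> ball x r \<subseteq> ball x0 r0 \<longrightarrow>
        emeasure \<mu> (ball x (2 * r)) \<le> ennreal C * emeasure \<mu> (ball x r))"

definition ball_mean :: "'a::metric_space measure \<Rightarrow> 'a set \<Rightarrow> ('a \<Rightarrow> ereal) \<Rightarrow> real" where
  "ball_mean \<mu> B u = (LINT x:B|\<mu>. real_of_ereal (u x)) / measure \<mu> B"

text \<open>
  Here \<open>u\<close> is a function on \<open>\<lambda>B\<close> and \<open>g\<close> is a \<open>p\<close>-weak upper gradient of \<open>u\<close> in \<open>\<lambda>B\<close>.  An integrable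
  \<open>u\<close> is finite almost everywhere, so \<^const>\<open>real_of_ereal\<close> in the mean value loses nothing.
\<close>

definition local_Poincare :: "real \<Rightarrow> 'a::metric_space measure \<Rightarrow> bool" where
  "local_Poincare p \<mu> \<longleftrightarrow>
     (\<forall>x0. \<exists>r0>0. \<exists>C>0. \<exists>\<Lambda>\<ge>1. \<forall>x r u g.
        0 < r \<and> ball x r \<subseteq> ball x0 r0 \<and>
        u \<in> borel_measurable (restrict_space \<mu> (ball x (\<Lambda> * r))) \<and>
        (\<integral>\<^sup>+y\<in>ball x (\<Lambda> * r). e2ennreal \<bar>u y\<bar> \<partial>\<mu>) < \<infinity> \<and>
        weak_upper_gradient p \<mu> (ball x (\<Lambda> * r)) u g \<longrightarrow>
        (\<integral>\<^sup>+y\<in>ball x r. e2ennreal \<bar>u y - ereal (ball_mean \<mu> (ball x r) u)\<bar> \<partial>\<mu>)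
            / emeasure \<mu> (ball x r)
        \<le> ennreal (C * r) *
            ennpowr ((\<integral>\<^sup>+y\<in>ball x (\<Lambda> * r). ennpowr (g y) p \<partial>\<mu>)
                       / emeasure \<mu> (ball x (\<Lambda> * r))) (1 / p))"

text \<open>
  The integrals are over \<open>{\<phi> \<noteq> 0}\<close>; intersecting with \<open>\<Omega>\<close>, where \<open>u\<close> and its upper gradients live,
  discards only a null set.
\<close>

definition quasiminimizer ::
  "real \<Rightarrow> 'a::metric_space measure \<Rightarrow> 'a set \<Rightarrow> ('a \<Rightarrow> ereal) \<Rightarrow> bool" where
  "quasiminimizer p \<mu> \<Omega> u \<longleftrightarrow> u \<in> N1p_loc_dist p \<mu> \<Omega> \<and>
     (\<exists>Q\<ge>1. \<forall>\<phi>\<in>N1p_zero_dist p \<mu> \<Omega>.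
        (\<integral>\<^sup>+x\<in>{x \<in> \<Omega>. \<phi> x \<noteq> 0}. ennpowr (minimal_wug p \<mu> \<Omega> u x) p \<partial>\<mu>)
        \<le> ennreal Q *
          (\<integral>\<^sup>+x\<in>{x \<in> \<Omega>. \<phi> x \<noteq> 0}. ennpowr (minimal_wug p \<mu> \<Omega> (\<lambda>y. u y + \<phi> y) x) p \<partial>\<mu>))"

definition quasiharmonic ::
  "real \<Rightarrow> 'a::metric_space measure \<Rightarrow> 'a set \<Rightarrow> ('a \<Rightarrow> real) \<Rightarrow> bool" where
  "quasiharmonic p \<mu> \<Omega> u \<longleftrightarrow> continuous_on \<Omega> u \<and> quasiminimizer p \<mu> \<Omega> (\<lambda>x. ereal (u x))"

end

theory Submission
  imports Defs
begin

text \<open>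
  Only the inequality \<open>sup\<^sub>G u \<le> sup\<^sub>\<partial>\<^sub>G u\<close> has content; the other one is continuity of \<open>u\<close> on the
  closure of \<open>G\<close>, which lies in \<open>\<Omega>\<close>.  Suppose that \<open>u x > k > sup\<^sub>\<partial>\<^sub>G u\<close> for some \<open>x \<in> G\<close>, and put
  \<open>A = {y \<in> G. u y > k}\<close>.  The closure of \<open>A\<close> stays inside \<open>G\<close>, so \<open>\<phi> = k - u\<close> on \<open>A\<close> and \<open>\<phi> = 0\<close>
  elsewhere defines a continuous function on \<open>X\<close>, which is an admissible test function.  As \<open>u + \<phi>\<close> is
  constant on \<open>A\<close>, its minimal weak upper gradient vanishes almost everywhere on \<open>A\<close>; by
  quasiminimality so does that of \<open>u\<close>.  Hence \<open>0\<close> is a weak upper gradient of \<open>\<phi>\<close> on all of \<open>X\<close>, the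
  Poincare inequality makes \<open>\<phi>\<close> locally constant, and connectedness makes it constant.  It vanishes
  outside \<open>G\<close> and is negative at \<open>x\<close>, a contradiction (\<open>quasiharmonic_le_boundary_sup\<close>).

  Most of the work lies in the fact that minimal weak upper gradients exist
  (\<open>is_minimal_wug_minimal_wug\<close>) and are local (\<open>is_minimal_wug_zero_where_constant\<close>).  Both come from
  one statement: a countable infimum of weak upper gradients, each of which may be known only on an
  open set, is again a weak upper gradient (\<open>weak_upper_gradient_INF\<close>).  Along a single curve this is
  a statement about a real function \<open>w\<close> on an interval whose increments are bounded by the integrals
  of several densities (\<open>increments_bounded_INF\<close>), and it is proved there by regularity of finite
  measures on the line.  The exceptional curves are absorbed by a countable union, and
  \<open>L\<^sup>p\<^sub>l\<^sub>o\<^sub>c\<close>-densities have finite integral along almost every curve because a space in which all balls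
  have positive finite measure is separable.  The minimal gradient is then the essential infimum of
  all gradients.
\<close>

section \<open>Increments along an interval\<close>

definition increments_bounded ::
  "(real \<Rightarrow> real) \<Rightarrow> real \<Rightarrow> real \<Rightarrow> real set \<Rightarrow> (real \<Rightarrow> ennreal) \<Rightarrow> bool" where
  "increments_bounded w a b U f \<longleftrightarrow>
     (\<forall>s t. a \<le> s \<and> s \<le> t \<and> t \<le> b \<and> {s..t} \<subseteq> U \<longrightarrow>
        ennreal \<bar>w s - w t\<bar> \<le> (\<integral>\<^sup>+x\<in>{s..t}. f x \<partial>lborel))"

lemma increments_boundedD:
  "increments_bounded w a b U f \<Longrightarrow> a \<le> s \<Longrightarrow> s \<le> t \<Longrightarrow> t \<le> b \<Longrightarrow> {s..t} \<subseteq> U \<Longrightarrow>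
    ennreal \<bar>w s - w t\<bar> \<le> (\<integral>\<^sup>+x\<in>{s..t}. f x \<partial>lborel)"
  unfolding increments_bounded_def by blast

lemma nn_integral_Icc_add:
  fixes q :: "real \<Rightarrow> ennreal"
  assumes [measurable]: "q \<in> borel_measurable borel" and "s \<le> t" "t \<le> r"
  shows "(\<integral>\<^sup>+x\<in>{s..r}. q x \<partial>lborel) = (\<integral>\<^sup>+x\<in>{s..t}. q x \<partial>lborel) + (\<integral>\<^sup>+x\<in>{t..r}. q x \<partial>lborel)"
proof -
  have "(\<integral>\<^sup>+x\<in>{s..r}. q x \<partial>lborel)
      = (\<integral>\<^sup>+x. q x * indicator {s..t} x + q x * indicator {t..r} x \<partial>lborel)"
    using AE_lborel_singleton[of t] assms(2,3)
    by (intro nn_integral_cong_AE) (auto elim!: eventually_mono split: split_indicator)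
  also have "\<dots> = (\<integral>\<^sup>+x\<in>{s..t}. q x \<partial>lborel) + (\<integral>\<^sup>+x\<in>{t..r}. q x \<partial>lborel)"
    by (rule nn_integral_add) auto
  finally show ?thesis .
qed

text \<open>
  A bound that is additive over adjacent intervals only has to be checked on short intervals: the
  increment over a long one is at most the sum of the increments over the pieces.
\<close>

lemma increment_bound_of_small_steps:
  fixes q :: "real \<Rightarrow> ennreal"
  assumes [measurable]: "q \<in> borel_measurable borel" and "0 < \<delta>" "a \<le> b"
    and small: "\<And>s t. a \<le> s \<Longrightarrow> s \<le> t \<Longrightarrow> t \<le> b \<Longrightarrow> t - s < \<delta> \<Longrightarrow>
      ennreal \<bar>w s - w t\<bar> \<le> (\<integral>\<^sup>+x\<in>{s..t}. q x \<partial>lborel)"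
  shows "ennreal \<bar>w a - w b\<bar> \<le> (\<integral>\<^sup>+x\<in>{a..b}. q x \<partial>lborel)"
proof -
  have *: "ennreal \<bar>w a - w t\<bar> \<le> (\<integral>\<^sup>+x\<in>{a..t}. q x \<partial>lborel)"
    if "a \<le> t" "t \<le> b" "t - a \<le> real n * (\<delta> / 2)" for n t
    using that
  proof (induction n arbitrary: t)
    case 0
    then show ?case using small[of a t] \<open>0 < \<delta>\<close> by simp
  next
    case (Suc n)
    show ?case
    proof (cases "t - a < \<delta>")
      case True
      then show ?thesis using small[of a t] Suc.prems by simp
    next
      case False
      define r where "r = t - \<delta> / 2"
      have r: "a \<le> r" "r \<le> t" "t - r < \<delta>" "r - a \<le> real n * (\<delta> / 2)"
        using False Suc.prems \<open>0 < \<delta>\<close> by (auto simp: r_def algebra_simps)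
      have "ennreal \<bar>w a - w t\<bar> \<le> ennreal (\<bar>w a - w r\<bar> + \<bar>w r - w t\<bar>)"
        by (rule ennreal_leI) simp
      also have "\<dots> = ennreal \<bar>w a - w r\<bar> + ennreal \<bar>w r - w t\<bar>"
        by simp
      also have "\<dots> \<le> (\<integral>\<^sup>+x\<in>{a..r}. q x \<partial>lborel) + (\<integral>\<^sup>+x\<in>{r..t}. q x \<partial>lborel)"
        using r Suc.prems by (intro add_mono Suc.IH small) auto
      also have "\<dots> = (\<integral>\<^sup>+x\<in>{a..t}. q x \<partial>lborel)"
        by (rule nn_integral_Icc_add[symmetric]) (use r in auto)
      finally show ?thesis .
    qed
  qed
  obtain n where "(b - a) / (\<delta> / 2) \<le> real n"
    using real_arch_simple by blast
  then show ?thesis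
    using *[of b n] \<open>0 < \<delta>\<close> \<open>a \<le> b\<close> by (simp add: field_simps)
qed

text \<open>
  Inner regularity for \<open>f1\<close> and outer regularity for \<open>f2\<close>, both as finite densities.  For a set \<open>E\<close> on
  which \<open>f2\<close> is the better bound, \<open>f1\<close> is kept outside \<open>K\<close> and \<open>f2\<close> is used inside \<open>V\<close>, at a cost of \<open>e\<close> each.
\<close>

lemma compact_open_approximation:
  fixes f1 f2 :: "real \<Rightarrow> ennreal"
  assumes [measurable]: "f1 \<in> borel_measurable borel" "f2 \<in> borel_measurable borel"
    and fin1: "(\<integral>\<^sup>+x. f1 x \<partial>lborel) < \<infinity>" and fin2: "(\<integral>\<^sup>+x. f2 x \<partial>lborel) < \<infinity>"
    and [measurable]: "E \<in> sets borel" and "0 < e"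
  obtains K V where "compact K" "K \<subseteq> E" "open V" "K \<subseteq> V"
    "(\<integral>\<^sup>+x\<in>E. f1 x \<partial>lborel) \<le> (\<integral>\<^sup>+x\<in>K. f1 x \<partial>lborel) + ennreal e"
    "(\<integral>\<^sup>+x\<in>V. f2 x \<partial>lborel) \<le> (\<integral>\<^sup>+x\<in>E. f2 x \<partial>lborel) + ennreal e"
proof -
  define M1 where "M1 = density lborel f1"
  define M2 where "M2 = density lborel f2"
  have M[simp]: "sets M1 = sets borel" "sets M2 = sets borel"
    by (simp_all add: M1_def M2_def)
  have em1: "emeasure M1 A = (\<integral>\<^sup>+x\<in>A. f1 x \<partial>lborel)" if "A \<in> sets borel" for A
    using that by (simp add: M1_def emeasure_density)
  have em2: "emeasure M2 A = (\<integral>\<^sup>+x\<in>A. f2 x \<partial>lborel)" if "A \<in> sets borel" for A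
    using that by (simp add: M2_def emeasure_density)
  have sp: "space M1 = UNIV" "space M2 = UNIV" by (simp_all add: M1_def M2_def)
  have f1: "emeasure M1 (space M1) \<noteq> \<infinity>" and f2: "emeasure M2 (space M2) \<noteq> \<infinity>"
    unfolding sp using fin1 fin2 by (auto simp: em1 em2 less_top)
  have E1: "emeasure M1 E \<noteq> \<infinity>"
    using f1 emeasure_mono[of E "space M1" M1] by (auto simp: sp top_unique)
  have "{K. K \<subseteq> E \<and> compact K} \<noteq> {}"
    by (auto intro: exI[of _ "{}"])
  from SUP_approx_ennreal[OF \<open>0 < e\<close> this inner_regular[OF M(1) f1 assms(5)] E1]
  obtain K where K: "K \<subseteq> E" "compact K" "emeasure M1 E < emeasure M1 K + ennreal e"
    by auto
  have Km[measurable]: "K \<in> sets borel" using K(2) by (rule borel_compact)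
  have K2: "emeasure M2 K \<noteq> \<infinity>"
    using f2 emeasure_mono[of K "space M2" M2] by (auto simp: sp top_unique)
  from INF_approx_ennreal[OF \<open>0 < e\<close> outer_regular[OF M(2) f2 Km] K2]
  obtain V where V: "K \<subseteq> V" "open V" "emeasure M2 V < emeasure M2 K + ennreal e"
    by auto
  have Vm[measurable]: "V \<in> sets borel" using V(2) by (rule borel_open)
  have "emeasure M2 K \<le> emeasure M2 E" using K by (intro emeasure_mono) auto
  then have "emeasure M2 K + ennreal e \<le> emeasure M2 E + ennreal e" by (rule add_right_mono)
  then have "emeasure M2 V \<le> emeasure M2 E + ennreal e"
    using V(3) by (meson less_imp_le order_trans)
  with K V show thesis
    by (intro that[of K V]) (simp_all add: em1[symmetric] em2[symmetric] less_imp_le)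
qed

text \<open>
  Where \<open>f2 < f1\<close>, the second bound should replace the first.  This set \<open>E\<close> is only measurable, but it
  contains a compact \<open>K\<close>, with an open neighbourhood \<open>V\<close>, such that using \<open>f1\<close> off \<open>K\<close> and \<open>f2\<close> in \<open>V\<close>
  costs little.  A sufficiently short interval either misses \<open>K\<close>, and the bound by \<open>f1\<close> is used on it,
  or it lies inside \<open>V \<inter> U\<close>, where the bound by \<open>f2\<close> is available.  Summing over a fine partition gives
  the claim up to \<open>e\<close>.
\<close>

lemma increment_bound_min:
  fixes f1 f2 :: "real \<Rightarrow> ennreal"
  assumes [measurable]: "f1 \<in> borel_measurable borel" "f2 \<in> borel_measurable borel"
    and fin1: "(\<integral>\<^sup>+x\<in>{a..b}. f1 x \<partial>lborel) < \<infinity>"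
    and fin2: "(\<integral>\<^sup>+x\<in>{a..b} \<inter> U. f2 x \<partial>lborel) < \<infinity>"
    and U: "open U" and ab: "a \<le> b"
    and b1: "increments_bounded w a b UNIV f1" and b2: "increments_bounded w a b U f2"
  shows "ennreal \<bar>w a - w b\<bar> \<le>
    (\<integral>\<^sup>+x\<in>{a..b}. (if x \<in> U then min (f1 x) (f2 x) else f1 x) \<partial>lborel)"
proof (rule ennreal_le_epsilon)
  fix e :: real assume e: "0 < e"
  define E where "E = {x \<in> {a..b} \<inter> U. f2 x < f1 x}"
  have [measurable]: "U \<in> sets borel" using U by auto
  have E[measurable]: "E \<in> sets borel" unfolding E_def by measurable
  have m1: "(\<lambda>x. f1 x * indicator {a..b} x) \<in> borel_measurable borel"
    and m2: "(\<lambda>x. f2 x * indicator ({a..b} \<inter> U) x) \<in> borel_measurable borel"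
    by measurable
  obtain K V where KV: "compact K" "K \<subseteq> E" "open V" "K \<subseteq> V"
    "(\<integral>\<^sup>+x\<in>E. (f1 x * indicator {a..b} x) \<partial>lborel) \<le> (\<integral>\<^sup>+x\<in>K. (f1 x * indicator {a..b} x) \<partial>lborel) + ennreal (e / 2)"
    "(\<integral>\<^sup>+x\<in>V. (f2 x * indicator ({a..b} \<inter> U) x) \<partial>lborel) \<le> (\<integral>\<^sup>+x\<in>E. (f2 x * indicator ({a..b} \<inter> U) x) \<partial>lborel) + ennreal (e / 2)"
    by (rule compact_open_approximation[OF m1 m2 fin1 fin2 E half_gt_zero[OF e]])
  have [measurable]: "K \<in> sets borel" "V \<in> sets borel"
    using KV(1,3) by (simp_all add: borel_compact)
  define q where "q x = f1 x * indicator ({a..b} - K) x + f2 x * indicator (V \<inter> U \<inter> {a..b}) x" for x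
  have [measurable]: "q \<in> borel_measurable borel" unfolding q_def by measurable
  have KU: "K \<subseteq> U" using KV(2) by (auto simp: E_def)
  \<comment> \<open>An interval of length less than \<open>\<delta>\<close> that meets \<open>K\<close> lies inside \<open>V \<inter> U\<close>.\<close>
  obtain \<delta> where \<delta>: "\<delta> > 0" "(\<Union>x\<in>K. ball x \<delta>) \<subseteq> V \<inter> U"
    using compact_subset_open_imp_ball_epsilon_subset[of K "V \<inter> U"] KV(1-4) U KU by blast
  have "ennreal \<bar>w a - w b\<bar> \<le> (\<integral>\<^sup>+x\<in>{a..b}. q x \<partial>lborel)"
  proof (rule increment_bound_of_small_steps[OF _ \<delta>(1) ab])
    fix s t assume st: "a \<le> s" "s \<le> t" "t \<le> b" "t - s < \<delta>"
    show "ennreal \<bar>w s - w t\<bar> \<le> (\<integral>\<^sup>+x\<in>{s..t}. q x \<partial>lborel)"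
    proof (cases "{s..t} \<inter> K = {}")
      case True
      have "ennreal \<bar>w s - w t\<bar> \<le> (\<integral>\<^sup>+x\<in>{s..t}. f1 x \<partial>lborel)"
        using increments_boundedD[OF b1, of s t] st by auto
      also have "\<dots> \<le> (\<integral>\<^sup>+x\<in>{s..t}. q x \<partial>lborel)"
        using True st by (intro nn_integral_mono) (auto simp: q_def split: split_indicator)
      finally show ?thesis .
    next
      case False
      then obtain y where y: "y \<in> {s..t}" "y \<in> K" by blast
      then have VU: "{s..t} \<subseteq> V \<inter> U"
        using \<delta>(2) st by (intro order_trans[OF _ \<delta>(2)]) (auto simp: dist_real_def intro!: bexI[of _ y])
      then have "ennreal \<bar>w s - w t\<bar> \<le> (\<integral>\<^sup>+x\<in>{s..t}. f2 x \<partial>lborel)"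
        using increments_boundedD[OF b2, of s t] st by auto
      also have "\<dots> \<le> (\<integral>\<^sup>+x\<in>{s..t}. q x \<partial>lborel)"
        using VU st by (intro nn_integral_mono) (auto simp: q_def split: split_indicator)
      finally show ?thesis .
    qed
  qed auto
  also have "(\<integral>\<^sup>+x\<in>{a..b}. q x \<partial>lborel)
      = (\<integral>\<^sup>+x. f1 x * indicator ({a..b} - K) x + f2 x * indicator (V \<inter> U \<inter> {a..b}) x \<partial>lborel)"
    by (intro nn_integral_cong) (auto simp: q_def split: split_indicator)
  also have "\<dots> = (\<integral>\<^sup>+x\<in>{a..b} - K. f1 x \<partial>lborel) + (\<integral>\<^sup>+x\<in>V \<inter> U \<inter> {a..b}. f2 x \<partial>lborel)"
    by (rule nn_integral_add) auto
  also have "(\<integral>\<^sup>+x\<in>{a..b} - K. f1 x \<partial>lborel) \<le> (\<integral>\<^sup>+x\<in>{a..b} - E. f1 x \<partial>lborel) + ennreal (e / 2)"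
  proof -
    have Kfin: "(\<integral>\<^sup>+x\<in>K. f1 x \<partial>lborel) \<noteq> \<infinity>"
    proof -
      have "(\<integral>\<^sup>+x\<in>K. f1 x \<partial>lborel) \<le> (\<integral>\<^sup>+x\<in>{a..b}. f1 x \<partial>lborel)"
        using KV(2) by (intro nn_integral_mono) (auto simp: E_def split: split_indicator)
      then show ?thesis using fin1 by (auto simp: top_unique)
    qed
    have "(\<integral>\<^sup>+x\<in>E. f1 x \<partial>lborel) = (\<integral>\<^sup>+x\<in>E. (f1 x * indicator {a..b} x) \<partial>lborel)"
      by (intro nn_integral_cong) (auto simp: E_def split: split_indicator)
    also have "\<dots> \<le> (\<integral>\<^sup>+x\<in>K. (f1 x * indicator {a..b} x) \<partial>lborel) + ennreal (e / 2)" by fact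
    also have "(\<integral>\<^sup>+x\<in>K. (f1 x * indicator {a..b} x) \<partial>lborel) = (\<integral>\<^sup>+x\<in>K. f1 x \<partial>lborel)"
      using KV(2) by (intro nn_integral_cong) (auto simp: E_def split: split_indicator)
    finally have EK: "(\<integral>\<^sup>+x\<in>E. f1 x \<partial>lborel) \<le> (\<integral>\<^sup>+x\<in>K. f1 x \<partial>lborel) + ennreal (e / 2)" .
    have "(\<integral>\<^sup>+x\<in>K. f1 x \<partial>lborel) + (\<integral>\<^sup>+x\<in>{a..b} - K. f1 x \<partial>lborel) = (\<integral>\<^sup>+x\<in>{a..b}. f1 x \<partial>lborel)"
      using KV(2) by (subst nn_integral_add[symmetric]) (auto intro!: nn_integral_cong simp: E_def split: split_indicator)
    also have "\<dots> = (\<integral>\<^sup>+x\<in>E. f1 x \<partial>lborel) + (\<integral>\<^sup>+x\<in>{a..b} - E. f1 x \<partial>lborel)"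
      by (subst nn_integral_add[symmetric]) (auto intro!: nn_integral_cong simp: E_def split: split_indicator)
    also have "\<dots> \<le> (\<integral>\<^sup>+x\<in>K. f1 x \<partial>lborel) + ((\<integral>\<^sup>+x\<in>{a..b} - E. f1 x \<partial>lborel) + ennreal (e / 2))"
      using EK by (simp add: ac_simps add_left_mono)
    finally show ?thesis using Kfin by (simp add: ennreal_add_left_cancel_le)
  qed
  also have "(\<integral>\<^sup>+x\<in>V \<inter> U \<inter> {a..b}. f2 x \<partial>lborel) \<le> (\<integral>\<^sup>+x\<in>E. f2 x \<partial>lborel) + ennreal (e / 2)"
  proof -
    have "(\<integral>\<^sup>+x\<in>V \<inter> U \<inter> {a..b}. f2 x \<partial>lborel) = (\<integral>\<^sup>+x\<in>V. (f2 x * indicator ({a..b} \<inter> U) x) \<partial>lborel)"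
      by (intro nn_integral_cong) (auto split: split_indicator)
    also note KV(6)
    also have "(\<integral>\<^sup>+x\<in>E. (f2 x * indicator ({a..b} \<inter> U) x) \<partial>lborel) = (\<integral>\<^sup>+x\<in>E. f2 x \<partial>lborel)"
      by (intro nn_integral_cong) (auto simp: E_def split: split_indicator)
    finally show ?thesis .
  qed
  also have "(\<integral>\<^sup>+x\<in>{a..b} - E. f1 x \<partial>lborel) + ennreal (e / 2) + ((\<integral>\<^sup>+x\<in>E. f2 x \<partial>lborel) + ennreal (e / 2))
     = ((\<integral>\<^sup>+x\<in>{a..b} - E. f1 x \<partial>lborel) + (\<integral>\<^sup>+x\<in>E. f2 x \<partial>lborel)) + (ennreal (e / 2) + ennreal (e / 2))"
    by (simp only: ac_simps)
  also have "ennreal (e / 2) + ennreal (e / 2) = ennreal e"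
    using e by (subst ennreal_plus[symmetric]) auto
  also have "(\<integral>\<^sup>+x\<in>{a..b} - E. f1 x \<partial>lborel) + (\<integral>\<^sup>+x\<in>E. f2 x \<partial>lborel)
      = (\<integral>\<^sup>+x\<in>{a..b}. (if x \<in> U then min (f1 x) (f2 x) else f1 x) \<partial>lborel)"
    by (subst nn_integral_add[symmetric])
       (auto intro!: nn_integral_cong simp: E_def min_def split: split_indicator)
  finally show "ennreal \<bar>w a - w b\<bar> \<le>
    (\<integral>\<^sup>+x\<in>{a..b}. (if x \<in> U then min (f1 x) (f2 x) else f1 x) \<partial>lborel) + ennreal e"
    by (simp add: add_mono)
qed

lemma increments_bounded_min:
  fixes f1 f2 :: "real \<Rightarrow> ennreal"
  assumes [measurable]: "f1 \<in> borel_measurable borel" "f2 \<in> borel_measurable borel"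
    and fin1: "(\<integral>\<^sup>+x\<in>{a..b}. f1 x \<partial>lborel) < \<infinity>"
    and fin2: "(\<integral>\<^sup>+x\<in>{a..b} \<inter> U. f2 x \<partial>lborel) < \<infinity>"
    and U: "open U"
    and b1: "increments_bounded w a b UNIV f1" and b2: "increments_bounded w a b U f2"
  shows "increments_bounded w a b UNIV (\<lambda>x. if x \<in> U then min (f1 x) (f2 x) else f1 x)"
  unfolding increments_bounded_def
proof (intro allI impI)
  fix s t assume st: "a \<le> s \<and> s \<le> t \<and> t \<le> b \<and> {s..t} \<subseteq> UNIV"
  have "(\<integral>\<^sup>+x\<in>{s..t}. f1 x \<partial>lborel) \<le> (\<integral>\<^sup>+x\<in>{a..b}. f1 x \<partial>lborel)"
    "(\<integral>\<^sup>+x\<in>{s..t} \<inter> U. f2 x \<partial>lborel) \<le> (\<integral>\<^sup>+x\<in>{a..b} \<inter> U. f2 x \<partial>lborel)"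
    using st by (auto intro!: nn_integral_mono split: split_indicator)
  then show "ennreal \<bar>w s - w t\<bar> \<le>
      (\<integral>\<^sup>+x\<in>{s..t}. (if x \<in> U then min (f1 x) (f2 x) else f1 x) \<partial>lborel)"
    using st fin1 fin2 b1 b2 U
    by (intro increment_bound_min) (auto simp: increments_bounded_def)
qed

text \<open>
  The finite minima follow from the case of two densities; the infimum is their decreasing limit, and
  the integrals converge because the first of them is finite.  Letting the \<open>n\<close>-th density act only on
  \<open>U n\<close> is what later allows gradients that are known on different open sets to be glued.
\<close>

lemma increments_bounded_INF:
  fixes f :: "nat \<Rightarrow> real \<Rightarrow> ennreal" and U :: "nat \<Rightarrow> real set"
  assumes meas[measurable]: "\<And>n. f n \<in> borel_measurable borel"
    and fin: "\<And>n. (\<integral>\<^sup>+x\<in>{a..b} \<inter> U n. f n x \<partial>lborel) < \<infinity>"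
    and U: "\<And>n. open (U n)"
    and bd: "\<And>n. increments_bounded w a b (U n) (f n)"
    and N: "{a..b} \<subseteq> U N"
  shows "increments_bounded w a b UNIV (\<lambda>x. INF n\<in>{n. x \<in> U n}. f n x)"
proof -
  have [measurable]: "U n \<in> sets borel" for n using U by auto
  \<comment> \<open>Starting from \<open>f N\<close>, which acts on the whole interval, keeps every \<open>F k\<close> integrable.\<close>
  define F where "F k x = min (f N x) (INF n\<in>{n. n < k \<and> x \<in> U n}. f n x)" for k x
  have F_Suc: "F (Suc k) = (\<lambda>x. if x \<in> U k then min (F k x) (f k x) else F k x)" for k
  proof
    fix x
    have "{n. n < Suc k \<and> x \<in> U n} =
        (if x \<in> U k then insert k {n. n < k \<and> x \<in> U n} else {n. n < k \<and> x \<in> U n})"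
      by (auto simp: less_Suc_eq)
    then show "F (Suc k) x = (if x \<in> U k then min (F k x) (f k x) else F k x)"
      by (simp add: F_def inf_min ac_simps)
  qed
  have finN: "(\<integral>\<^sup>+x\<in>{a..b}. f N x \<partial>lborel) < \<infinity>"
    using fin[of N] N by (simp add: inf.absorb1)
  have F_meas[measurable]: "F k \<in> borel_measurable borel" for k
  proof (induction k)
    case 0
    have "F 0 = f N" by (simp add: F_def fun_eq_iff)
    then show ?case by simp
  next
    case (Suc k)
    then have [measurable]: "F k \<in> borel_measurable borel" .
    show ?case unfolding F_Suc by measurable
  qed
  have F_fin: "(\<integral>\<^sup>+x\<in>{s..t}. F k x \<partial>lborel) < \<infinity>" if "a \<le> s" "t \<le> b" for k s t
  proof -
    have "(\<integral>\<^sup>+x\<in>{s..t}. F k x \<partial>lborel) \<le> (\<integral>\<^sup>+x\<in>{a..b}. f N x \<partial>lborel)"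
      using that by (intro nn_integral_mono) (auto simp: F_def split: split_indicator)
    then show ?thesis using finN by (auto intro: order.strict_trans1)
  qed
  have F_bd: "increments_bounded w a b UNIV (F k)" for k
  proof (induction k)
    case 0
    have "F 0 = f N" by (simp add: F_def fun_eq_iff)
    moreover have "{s..t} \<subseteq> U N" if "a \<le> s" "t \<le> b" for s t
      using that by (intro order_trans[OF _ N]) auto
    ultimately show ?case
      using bd[of N] unfolding increments_bounded_def by simp
  next
    case (Suc k)
    show ?case unfolding F_Suc
      by (rule increments_bounded_min[OF F_meas meas F_fin[OF order_refl order_refl] fin U Suc.IH bd])
  qed
  have F_dec: "F (Suc k) x \<le> F k x" for k x
    unfolding F_Suc by simp
  have F_INF: "(INF k. F k x) = (INF n\<in>{n. x \<in> U n}. f n x)" if "x \<in> {a..b}" for x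
  proof (rule antisym)
    show "(INF k. F k x) \<le> (INF n\<in>{n. x \<in> U n}. f n x)"
    proof (rule INF_greatest)
      fix n assume "n \<in> {n. x \<in> U n}"
      then have "F (Suc n) x \<le> f n x" unfolding F_Suc by simp
      then show "(INF k. F k x) \<le> f n x" by (rule INF_lower2[OF UNIV_I])
    qed
    show "(INF n\<in>{n. x \<in> U n}. f n x) \<le> (INF k. F k x)"
      using N that unfolding F_def
      by (intro INF_greatest min.boundedI INF_superset_mono INF_lower) auto
  qed
  show ?thesis
    unfolding increments_bounded_def
  proof (intro allI impI)
    fix s t assume st: "a \<le> s \<and> s \<le> t \<and> t \<le> b \<and> {s..t} \<subseteq> UNIV"
    have "ennreal \<bar>w s - w t\<bar> \<le> (INF k. \<integral>\<^sup>+x\<in>{s..t}. F k x \<partial>lborel)"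
      using F_bd st by (auto intro!: INF_greatest simp: increments_bounded_def)
    also have "\<dots> = (\<integral>\<^sup>+x. (INF k. F k x * indicator {s..t} x) \<partial>lborel)"
      using F_fin[of s t 0] st
      by (intro nn_integral_monotone_convergence_INF_decseq[symmetric])
         (auto intro!: decseq_SucI le_funI mult_right_mono F_dec)
    also have "\<dots> = (\<integral>\<^sup>+x\<in>{s..t}. (INF n\<in>{n. x \<in> U n}. f n x) \<partial>lborel)"
      using st F_INF by (intro nn_integral_cong) (auto split: split_indicator)
    finally show "ennreal \<bar>w s - w t\<bar> \<le> (\<integral>\<^sup>+x\<in>{s..t}. (INF n\<in>{n. x \<in> U n}. f n x) \<partial>lborel)" .
  qed
qed

section \<open>Curves and line integrals\<close>

lemma curve_length_shift_le:
  "curve_length (\<lambda>\<tau>. \<gamma> (c + \<tau>)) a b \<le> curve_length \<gamma> (c + a) (c + b)"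
  unfolding curve_length_def
proof (rule SUP_least, clarify)
  fix n :: nat and t :: "nat \<Rightarrow> real"
  assume t: "mono_on {..n} t" "a = t 0" "b = t n"
  show "(\<Sum>i<n. ennreal (dist (\<gamma> (c + t i)) (\<gamma> (c + t (Suc i))))) \<le>
    (SUP (m, r) \<in> {(m, r). mono_on {..m} r \<and> r 0 = c + t 0 \<and> r m = c + t n}.
        \<Sum>i<m. ennreal (dist (\<gamma> (r i)) (\<gamma> (r (Suc i)))))"
    by (rule SUP_upper2[of "(n, \<lambda>i. c + t i)"]) (use t in \<open>auto simp: monotone_on_def\<close>)
qed

lemma curve_length_shift:
  "curve_length (\<lambda>\<tau>. \<gamma> (c + \<tau>)) a b = curve_length \<gamma> (c + a) (c + b)"
  using curve_length_shift_le[of \<gamma> c a b]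
    curve_length_shift_le[of "\<lambda>\<tau>. \<gamma> (c + \<tau>)" "- c" "c + a" "c + b"]
  by (simp add: antisym)

lemma arc_curve_subcurve:
  assumes "arc_curve E \<gamma> l" "0 \<le> s" "s < t" "t \<le> l" "\<gamma> ` {s..t} \<subseteq> E'"
  shows "arc_curve E' (\<lambda>\<tau>. \<gamma> (s + \<tau>)) (t - s)"
  unfolding arc_curve_def
proof (intro conjI)
  have cont: "continuous_on {0..l} \<gamma>" using assms by (simp add: arc_curve_def)
  show "continuous_on {0..t - s} (\<lambda>\<tau>. \<gamma> (s + \<tau>))"
    using assms by (intro continuous_on_compose2[OF cont]) (auto intro!: continuous_intros)
  show "(\<lambda>\<tau>. \<gamma> (s + \<tau>)) ` {0..t - s} \<subseteq> E'"
    using assms by auto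
  show "\<forall>sa ta. 0 \<le> sa \<and> sa \<le> ta \<and> ta \<le> t - s \<longrightarrow>
    curve_length (\<lambda>\<tau>. \<gamma> (s + \<tau>)) sa ta = ennreal (ta - sa)"
    using assms by (auto simp: curve_length_shift arc_curve_def)
qed (use assms in auto)

lemma curve_integral_lborel: "curve_integral \<gamma> l g = (\<integral>\<^sup>+t\<in>{0..l}. g (\<gamma> t) \<partial>lborel)"
  unfolding curve_integral_def by (rule nn_integral_completion)

lemma borel_measurable_along_curve:
  fixes \<gamma> :: "real \<Rightarrow> 'a::metric_space" and g :: "'a \<Rightarrow> ennreal"
  assumes "g \<in> borel_measurable borel" "continuous_on {0..l} \<gamma>"
  shows "(\<lambda>t. g (\<gamma> t) * indicator {0..l} t) \<in> borel_measurable borel"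
proof -
  have "\<gamma> \<in> measurable (restrict_space borel {0..l}) borel"
    by (rule borel_measurable_continuous_on_restrict) fact
  then have "(\<lambda>t. g (\<gamma> t)) \<in> borel_measurable (restrict_space borel {0..l})"
    by (rule measurable_compose) fact
  then show ?thesis by (subst (asm) borel_measurable_restrict_space_iff_ennreal) auto
qed

lemma curve_integral_subcurve:
  fixes g :: "'a::metric_space \<Rightarrow> ennreal"
  assumes g: "g \<in> borel_measurable borel" and \<gamma>: "continuous_on {0..l} \<gamma>" and "0 \<le> s" "t \<le> l"
  shows "curve_integral (\<lambda>\<tau>. \<gamma> (s + \<tau>)) (t - s) g = (\<integral>\<^sup>+\<tau>\<in>{s..t}. g (\<gamma> \<tau>) \<partial>lborel)"
proof -
  note [measurable] = borel_measurable_along_curve[OF g \<gamma>]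
  have "(\<integral>\<^sup>+\<tau>\<in>{s..t}. g (\<gamma> \<tau>) \<partial>lborel)
      = (\<integral>\<^sup>+\<tau>. (g (\<gamma> \<tau>) * indicator {0..l} \<tau>) * indicator {s..t} \<tau> \<partial>lborel)"
    using assms(3,4) by (intro nn_integral_cong) (auto split: split_indicator)
  also have "\<dots> = (\<integral>\<^sup>+\<tau>. (g (\<gamma> (s + \<tau>)) * indicator {0..l} (s + \<tau>)) * indicator {s..t} (s + \<tau>) \<partial>lborel)"
    by (subst nn_integral_real_affine[where c = 1 and t = s]) auto
  also have "\<dots> = (\<integral>\<^sup>+\<tau>\<in>{0..t - s}. g (\<gamma> (s + \<tau>)) \<partial>lborel)"
    using assms(3,4) by (intro nn_integral_cong) (auto split: split_indicator)
  finally show ?thesis by (simp add: curve_integral_lborel)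
qed

section \<open>Powers, and measurability modulo null sets\<close>

lemma ennpowr_mono: "x \<le> y \<Longrightarrow> 0 \<le> a \<Longrightarrow> ennpowr x a \<le> ennpowr y a"
  unfolding ennpowr_def
  by (auto simp: top_unique less_top intro!: ennreal_leI powr_mono2 enn2real_mono)

lemma ennpowr_0 [simp]: "ennpowr 0 a = 0"
  by (simp add: ennpowr_def)

lemma ennpowr_eq_0_iff [simp]: "ennpowr x a = 0 \<longleftrightarrow> x = 0"
  by (cases x) (auto simp: ennpowr_def)

lemma ennpowr_ennreal: "0 \<le> r \<Longrightarrow> ennpowr (ennreal r) a = ennreal (r powr a)"
  by (simp add: ennpowr_def)

lemma ennpowr_ennpowr: "ennpowr (ennpowr x a) b = ennpowr x (a * b)"
  by (simp add: ennpowr_def powr_powr)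

lemma ennpowr_1 [simp]: "ennpowr x 1 = x"
  by (cases x) (auto simp: ennpowr_def)

lemma ennpowr_mult: "ennpowr (x * y) a = ennpowr x a * ennpowr y a"
proof (cases x; cases y)
  fix r s :: real assume "x = ennreal r" "0 \<le> r" "y = ennreal s" "0 \<le> s"
  then show ?thesis
    by (simp add: ennpowr_ennreal ennreal_mult[symmetric] powr_mult)
qed (auto simp: ennpowr_def ennreal_mult_top ennreal_top_mult)

lemma ennpowr_indicator: "ennpowr (x * indicator A y) a = ennpowr x a * indicator A y"
  by (auto split: split_indicator)

lemma borel_measurable_ennpowr [measurable (raw)]:
  assumes [measurable]: "f \<in> borel_measurable M"
  shows "(\<lambda>x. ennpowr (f x) a) \<in> borel_measurable M"
  unfolding ennpowr_def by measurable

lemma mms_space: "metric_measure_space \<mu> \<Longrightarrow> space \<mu> = UNIV"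
  unfolding metric_measure_space_def by (auto dest: sets_eq_imp_space_eq)

lemma mms_sets: "metric_measure_space \<mu> \<Longrightarrow> A \<in> sets borel \<Longrightarrow> A \<in> sets \<mu>"
  unfolding metric_measure_space_def by auto

lemma mms_measurable:
  "metric_measure_space \<mu> \<Longrightarrow> f \<in> measurable borel N \<Longrightarrow> f \<in> measurable \<mu> N"
  unfolding metric_measure_space_def by (auto intro!: measurable_completion)

lemma mms_null_borel_cover:
  assumes "metric_measure_space \<mu>" "N \<in> null_sets \<mu>"
  obtains N' where "N \<subseteq> N'" "N' \<in> null_sets \<mu>" "N' \<in> sets borel"
proof -
  obtain \<nu> where \<nu>: "sets \<nu> = sets borel" "\<mu> = completion \<nu>"
    using assms(1) unfolding metric_measure_space_def by auto
  then obtain N' where "N' \<in> null_sets \<nu>" "N \<subseteq> N'"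
    using assms(2) by (auto simp: null_sets_completion_iff2)
  with \<nu> show thesis by (intro that[of N']) (auto intro: null_sets_completionI)
qed

lemma mms_borel_version:
  fixes g :: "'a::metric_space \<Rightarrow> ennreal"
  assumes "metric_measure_space \<mu>" "E \<in> sets borel"
    and g: "g \<in> borel_measurable (restrict_space \<mu> E)"
  obtains g' where "g' \<in> borel_measurable borel" "AE x in \<mu>. x \<in> E \<longrightarrow> g x = g' x"
proof -
  obtain \<nu> where \<nu>: "sets \<nu> = sets borel" "\<mu> = completion \<nu>"
    using assms(1) unfolding metric_measure_space_def by auto
  have "(\<lambda>x. g x * indicator E x) \<in> borel_measurable \<mu>"
    using g assms(2) mms_sets[OF assms(1)] mms_space[OF assms(1)]
    by (subst (asm) borel_measurable_restrict_space_iff_ennreal) auto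
  then obtain g' where g': "g' \<in> borel_measurable \<nu>" "AE x in \<nu>. g x * indicator E x = g' x"
    using completion_ex_borel_measurable unfolding \<nu>(2) by blast
  show thesis
  proof
    show "g' \<in> borel_measurable borel"
      using g'(1) \<nu>(1) measurable_cong_sets by blast
    have "AE x in \<mu>. g x * indicator E x = g' x"
      unfolding \<nu>(2) by (rule AE_completion) (rule g'(2))
    then show "AE x in \<mu>. x \<in> E \<longrightarrow> g x = g' x"
      by eventually_elim (auto split: split_indicator)
  qed
qed

section \<open>Exceptional families of curves\<close>

lemma ae_curve_mono:
  assumes "ae_curve p \<mu> E P" "\<And>\<gamma> l. arc_curve E \<gamma> l \<Longrightarrow> P \<gamma> l \<Longrightarrow> Q \<gamma> l"
  shows "ae_curve p \<mu> E Q"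
  using assms unfolding ae_curve_def by blast

lemma ae_curveI:
  assumes "\<rho> \<in> borel_measurable borel" "(\<integral>\<^sup>+x\<in>E. ennpowr (\<rho> x) p \<partial>\<mu>) < \<infinity>"
    and "\<And>\<gamma> l. arc_curve E \<gamma> l \<Longrightarrow> curve_integral \<gamma> l \<rho> < \<infinity> \<Longrightarrow> P \<gamma> l"
  shows "ae_curve p \<mu> E P"
  unfolding ae_curve_def
proof (intro exI[of _ \<rho>] conjI allI impI)
  fix \<gamma> l assume "arc_curve E \<gamma> l \<and> \<not> P \<gamma> l"
  then show "curve_integral \<gamma> l \<rho> = \<infinity>"
    using assms(3)[of \<gamma> l] by (cases "curve_integral \<gamma> l \<rho> < \<infinity>") (auto simp: less_top[symmetric])
qed (use assms in \<open>auto simp: measurable_restrict_space1\<close>)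

lemma ae_curveE:
  assumes "ae_curve p \<mu> E P" "E \<in> sets borel"
  obtains \<rho> where "\<rho> \<in> borel_measurable borel" "(\<integral>\<^sup>+x. ennpowr (\<rho> x) p \<partial>\<mu>) < \<infinity>"
    "\<And>\<gamma> l. arc_curve E \<gamma> l \<Longrightarrow> \<not> P \<gamma> l \<Longrightarrow> curve_integral \<gamma> l \<rho> = \<infinity>"
proof -
  obtain \<rho> where \<rho>: "\<rho> \<in> borel_measurable (restrict_space borel E)"
    "(\<integral>\<^sup>+x\<in>E. ennpowr (\<rho> x) p \<partial>\<mu>) < \<infinity>"
    "\<And>\<gamma> l. arc_curve E \<gamma> l \<Longrightarrow> \<not> P \<gamma> l \<Longrightarrow> curve_integral \<gamma> l \<rho> = \<infinity>"
    using assms(1) unfolding ae_curve_def by blast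
  show thesis
  proof
    show "(\<lambda>x. \<rho> x * indicator E x) \<in> borel_measurable borel"
      using \<rho>(1) assms(2) by (subst (asm) borel_measurable_restrict_space_iff_ennreal) auto
    show "(\<integral>\<^sup>+x. ennpowr (\<rho> x * indicator E x) p \<partial>\<mu>) < \<infinity>"
      using \<rho>(2) by (simp add: ennpowr_indicator)
    fix \<gamma> l assume \<gamma>: "arc_curve E \<gamma> l" "\<not> P \<gamma> l"
    then have "curve_integral \<gamma> l (\<lambda>x. \<rho> x * indicator E x) = curve_integral \<gamma> l \<rho>"
      unfolding curve_integral_def
      by (intro nn_integral_cong) (auto simp: arc_curve_def image_subset_iff split: split_indicator)
    then show "curve_integral \<gamma> l (\<lambda>x. \<rho> x * indicator E x) = \<infinity>"
      using \<rho>(3)[OF \<gamma>] by simp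
  qed
qed

text \<open>
  Countable unions of exceptional families are exceptional.  The density is chosen as
  \<open>(\<Sum>n. c n * \<rho> n ^ p) ^ (1 / p)\<close> because its \<open>p\<close>-th power can be integrated termwise and it
  dominates a positive multiple of every \<open>\<rho> n\<close>.
\<close>

lemma ae_curve_all:
  fixes P :: "nat \<Rightarrow> (real \<Rightarrow> 'a::metric_space) \<Rightarrow> real \<Rightarrow> bool"
  assumes mms: "metric_measure_space \<mu>" and p: "0 < p" and E: "E \<in> sets borel"
    and P: "\<And>n. ae_curve p \<mu> E (P n)"
  shows "ae_curve p \<mu> E (\<lambda>\<gamma> l. \<forall>n. P n \<gamma> l)"
proof -
  have "\<exists>\<rho>. \<rho> \<in> borel_measurable borel \<and> (\<integral>\<^sup>+x. ennpowr (\<rho> x) p \<partial>\<mu>) < \<infinity> \<and>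
    (\<forall>\<gamma> l. arc_curve E \<gamma> l \<longrightarrow> \<not> P n \<gamma> l \<longrightarrow> curve_integral \<gamma> l \<rho> = \<infinity>)" for n
    by (rule ae_curveE[OF P[of n] E]) blast
  then obtain \<rho> where \<rho>[measurable]: "\<And>n. \<rho> n \<in> borel_measurable borel"
    and fin: "\<And>n. (\<integral>\<^sup>+x. ennpowr (\<rho> n x) p \<partial>\<mu>) < \<infinity>"
    and exc: "\<And>n \<gamma> l. arc_curve E \<gamma> l \<Longrightarrow> \<not> P n \<gamma> l \<Longrightarrow> curve_integral \<gamma> l (\<rho> n) = \<infinity>"
    by metis
  have [measurable]: "\<rho> n \<in> borel_measurable \<mu>" for n
    by (rule mms_measurable[OF mms]) simp
  define I where "I n = enn2real (\<integral>\<^sup>+x. ennpowr (\<rho> n x) p \<partial>\<mu>)" for n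
  have I: "(\<integral>\<^sup>+x. ennpowr (\<rho> n x) p \<partial>\<mu>) = ennreal (I n)" "0 \<le> I n" for n
    using fin[of n] by (simp_all add: I_def less_top)
  \<comment> \<open>These weights make the integrals of the terms below a geometric series.\<close>
  define c where "c n = (1/2)^n / (1 + I n)" for n
  have c: "0 < c n" for n using I(2)[of n] by (simp add: c_def add_pos_nonneg)
  define r where "r x = (\<Sum>n. ennreal (c n) * ennpowr (\<rho> n x) p)" for x
  define R where "R x = ennpowr (r x) (1 / p)" for x
  have [measurable]: "r \<in> borel_measurable borel" unfolding r_def by measurable
  show ?thesis
  proof (rule ae_curveI)
    show "R \<in> borel_measurable borel" unfolding R_def by measurable
    have "(\<integral>\<^sup>+x\<in>E. ennpowr (R x) p \<partial>\<mu>) \<le> (\<integral>\<^sup>+x. r x \<partial>\<mu>)"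
      using p by (intro nn_integral_mono) (auto simp: R_def ennpowr_ennpowr split: split_indicator)
    also have "\<dots> = (\<Sum>n. \<integral>\<^sup>+x. ennreal (c n) * ennpowr (\<rho> n x) p \<partial>\<mu>)"
      unfolding r_def by (rule nn_integral_suminf) measurable
    also have "\<dots> = (\<Sum>n. ennreal (c n * I n))"
      using c I by (simp add: nn_integral_cmult ennreal_mult less_imp_le)
    also have "\<dots> \<le> (\<Sum>n. ennreal ((1/2)^n))"
    proof (intro suminf_le ennreal_leI)
      fix n
      have "(1/2)^n * (I n / (1 + I n)) \<le> (1/2)^n * (1::real)"
        using I(2)[of n] by (intro mult_left_mono) (auto simp: divide_le_eq)
      then show "c n * I n \<le> (1 / 2) ^ n"
        by (simp add: c_def)
    qed auto
    also have "\<dots> = ennreal (\<Sum>n. (1/2)^n)"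
      by (intro suminf_ennreal2) (auto simp: summable_geometric)
    finally show "(\<integral>\<^sup>+x\<in>E. ennpowr (R x) p \<partial>\<mu>) < \<infinity>"
      by (auto intro: order.strict_trans1)
    fix \<gamma> l assume \<gamma>: "arc_curve E \<gamma> l" and R: "curve_integral \<gamma> l R < \<infinity>"
    show "\<forall>n. P n \<gamma> l"
    proof (rule ccontr)
      assume "\<not> (\<forall>n. P n \<gamma> l)"
      then obtain n where "\<not> P n \<gamma> l" by blast
      then have inf: "curve_integral \<gamma> l (\<rho> n) = \<infinity>" by (rule exc[OF \<gamma>])
      define d where "d = ennpowr (ennreal (c n)) (1 / p)"
      have d: "d \<noteq> 0" using c[of n] by (simp add: d_def ennreal_eq_0_iff not_le)
      have le: "d * \<rho> n x \<le> R x" for x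
      proof -
        have "sum (\<lambda>k. ennreal (c k) * ennpowr (\<rho> k x) p) {n} \<le> r x"
          unfolding r_def by (rule sum_le_suminf) auto
        then have "ennpowr (ennreal (c n) * ennpowr (\<rho> n x) p) (1 / p) \<le> R x"
          unfolding R_def using p by (intro ennpowr_mono) auto
        then show ?thesis using p by (simp add: ennpowr_mult ennpowr_ennpowr d_def)
      qed
      have cont: "continuous_on {0..l} \<gamma>" using \<gamma> by (simp add: arc_curve_def)
      have "d * curve_integral \<gamma> l (\<rho> n) = (\<integral>\<^sup>+t. d * (\<rho> n (\<gamma> t) * indicator {0..l} t) \<partial>lborel)"
        unfolding curve_integral_lborel
        by (rule nn_integral_cmult[symmetric])
           (use borel_measurable_along_curve[OF \<rho> cont] in simp)
      also have "\<dots> \<le> curve_integral \<gamma> l R"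
        unfolding curve_integral_lborel
        by (intro nn_integral_mono) (auto simp: le split: split_indicator)
      finally show False using R inf d by (simp add: ennreal_mult_top)
    qed
  qed
qed

lemma ae_curve_conj:
  assumes "metric_measure_space \<mu>" "0 < p" "E \<in> sets borel"
    and "ae_curve p \<mu> E P" "ae_curve p \<mu> E Q"
  shows "ae_curve p \<mu> E (\<lambda>\<gamma> l. P \<gamma> l \<and> Q \<gamma> l)"
proof -
  have "ae_curve p \<mu> E (\<lambda>\<gamma> l. \<forall>n::nat. if n = 0 then P \<gamma> l else Q \<gamma> l)"
  proof (rule ae_curve_all[OF assms(1-3)])
    show "ae_curve p \<mu> E (\<lambda>\<gamma> l. if n = 0 then P \<gamma> l else Q \<gamma> l)" for n :: nat
      using assms(4,5) by (cases "n = 0") simp_all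
  qed
  then show ?thesis
    by (rule ae_curve_mono) (metis zero_neq_one)
qed

text \<open>
  A density with infinite integral over a subcurve has infinite integral over the whole curve, so the
  density that is exceptional for \<open>E'\<close> also serves for the curves that merely pass through \<open>E'\<close>.
\<close>

lemma ae_curve_subcurves:
  assumes P: "ae_curve p \<mu> E' P" and E': "E' \<in> sets borel"
  shows "ae_curve p \<mu> E (\<lambda>\<gamma> l. \<forall>s t. 0 \<le> s \<and> s < t \<and> t \<le> l \<and> \<gamma> ` {s..t} \<subseteq> E' \<longrightarrow>
    P (\<lambda>\<tau>. \<gamma> (s + \<tau>)) (t - s))"
proof -
  obtain \<rho> where \<rho>: "\<rho> \<in> borel_measurable borel" "(\<integral>\<^sup>+x. ennpowr (\<rho> x) p \<partial>\<mu>) < \<infinity>"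
    "\<And>\<gamma> l. arc_curve E' \<gamma> l \<Longrightarrow> \<not> P \<gamma> l \<Longrightarrow> curve_integral \<gamma> l \<rho> = \<infinity>"
    using ae_curveE[OF P E'] by blast
  show ?thesis
  proof (rule ae_curveI[OF \<rho>(1)])
    have "(\<integral>\<^sup>+x\<in>E. ennpowr (\<rho> x) p \<partial>\<mu>) \<le> (\<integral>\<^sup>+x. ennpowr (\<rho> x) p \<partial>\<mu>)"
      by (intro nn_integral_mono) (auto split: split_indicator)
    then show "(\<integral>\<^sup>+x\<in>E. ennpowr (\<rho> x) p \<partial>\<mu>) < \<infinity>"
      using \<rho>(2) by (rule order.strict_trans1)
    fix \<gamma> l assume \<gamma>: "arc_curve E \<gamma> l" and fin: "curve_integral \<gamma> l \<rho> < \<infinity>"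
    show "\<forall>s t. 0 \<le> s \<and> s < t \<and> t \<le> l \<and> \<gamma> ` {s..t} \<subseteq> E' \<longrightarrow> P (\<lambda>\<tau>. \<gamma> (s + \<tau>)) (t - s)"
    proof (intro allI impI, elim conjE, rule ccontr)
      fix s t assume st: "0 \<le> s" "s < t" "t \<le> l" "\<gamma> ` {s..t} \<subseteq> E'"
        and nP: "\<not> P (\<lambda>\<tau>. \<gamma> (s + \<tau>)) (t - s)"
      have "curve_integral (\<lambda>\<tau>. \<gamma> (s + \<tau>)) (t - s) \<rho> = \<infinity>"
        by (rule \<rho>(3)[OF arc_curve_subcurve[OF \<gamma> st] nP])
      moreover have "curve_integral (\<lambda>\<tau>. \<gamma> (s + \<tau>)) (t - s) \<rho> \<le> curve_integral \<gamma> l \<rho>"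
        using \<gamma> st \<rho>(1) unfolding curve_integral_lborel[of \<gamma>]
        by (subst curve_integral_subcurve)
           (auto simp: arc_curve_def intro!: nn_integral_mono split: split_indicator)
      ultimately show False using fin by (simp add: top_unique)
    qed
  qed
qed

text \<open>
  The density that is infinite on a Borel null set containing the exceptional points has \<open>L\<^sup>p\<close>-norm
  zero, and its integral is infinite along every curve that spends positive time in that set.
\<close>

lemma ae_curve_AE:
  assumes mms: "metric_measure_space \<mu>" and p: "0 < p"
    and Q: "AE x in \<mu>. x \<in> E \<longrightarrow> Q x"
  shows "ae_curve p \<mu> E (\<lambda>\<gamma> l. AE t in lborel. t \<in> {0..l} \<longrightarrow> Q (\<gamma> t))"
proof -
  obtain N where N: "{x \<in> space \<mu>. \<not> (x \<in> E \<longrightarrow> Q x)} \<subseteq> N" "N \<in> null_sets \<mu>"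
    using Q unfolding eventually_ae_filter by auto
  obtain N' where N': "N \<subseteq> N'" "N' \<in> null_sets \<mu>" "N' \<in> sets borel"
    by (rule mms_null_borel_cover[OF mms N(2)])
  define \<rho> :: "'a \<Rightarrow> ennreal" where "\<rho> x = \<infinity> * indicator N' x" for x
  have [measurable]: "\<rho> \<in> borel_measurable borel" using N'(3) unfolding \<rho>_def by measurable
  show ?thesis
  proof (rule ae_curveI)
    have "(\<integral>\<^sup>+x\<in>E. ennpowr (\<rho> x) p \<partial>\<mu>) \<le> (\<integral>\<^sup>+x\<in>N'. \<infinity> \<partial>\<mu>)"
      by (intro nn_integral_mono) (auto simp: \<rho>_def ennpowr_def split: split_indicator)
    also have "\<dots> = 0" by (rule nn_integral_null_set[OF N'(2)])
    finally show "(\<integral>\<^sup>+x\<in>E. ennpowr (\<rho> x) p \<partial>\<mu>) < \<infinity>" by simp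
    fix \<gamma> l assume \<gamma>: "arc_curve E \<gamma> l" and fin: "curve_integral \<gamma> l \<rho> < \<infinity>"
    have cont: "continuous_on {0..l} \<gamma>" using \<gamma> by (simp add: arc_curve_def)
    have "AE t in lborel. \<rho> (\<gamma> t) * indicator {0..l} t \<noteq> \<infinity>"
      using fin borel_measurable_along_curve[OF _ cont, of \<rho>] unfolding curve_integral_lborel
      by (intro nn_integral_PInf_AE) auto
    then show "AE t in lborel. t \<in> {0..l} \<longrightarrow> Q (\<gamma> t)"
    proof eventually_elim
      case (elim t)
      show ?case
      proof
        assume t: "t \<in> {0..l}"
        then have "\<gamma> t \<notin> N'" using elim by (auto simp: \<rho>_def)
        moreover have "\<gamma> t \<in> E" using \<gamma> t by (auto simp: arc_curve_def)
        ultimately show "Q (\<gamma> t)" using N N' mms_space[OF mms] by auto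
      qed
    qed
  qed simp
qed

lemma ae_curve_finite_integral:
  assumes "f \<in> borel_measurable borel" "(\<integral>\<^sup>+x\<in>E. ennpowr (f x) p \<partial>\<mu>) < \<infinity>"
  shows "ae_curve p \<mu> E (\<lambda>\<gamma> l. curve_integral \<gamma> l f < \<infinity>)"
  using assms by (rule ae_curveI)

section \<open>Separability and locally integrable densities\<close>

text \<open>
  Take a maximal separated set, by Zorn's lemma: a point at distance at least \<open>e\<close> from all its
  elements could be added to it.
\<close>

lemma maximal_separated_set:
  fixes e :: real
  assumes "0 < e"
  obtains S :: "'a::metric_space set" where "pairwise (\<lambda>x y. e \<le> dist x y) S" "\<And>x. \<exists>y\<in>S. dist x y < e"
proof -
  define \<A> where "\<A> = {S :: 'a set. pairwise (\<lambda>x y. e \<le> dist x y) S}"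
  have "\<exists>M\<in>\<A>. \<forall>X\<in>\<A>. M \<subseteq> X \<longrightarrow> X = M"
  proof (rule subset_Zorn')
    fix C assume "subset.chain \<A> C"
    then have C: "C \<subseteq> \<A>" "\<And>X Y. X \<in> C \<Longrightarrow> Y \<in> C \<Longrightarrow> X \<subseteq> Y \<or> Y \<subseteq> X"
      by (auto simp: subset.chain_def)
    show "\<Union>C \<in> \<A>"
      unfolding \<A>_def mem_Collect_eq pairwise_def
    proof (intro ballI impI)
      fix x y assume "x \<in> \<Union>C" "y \<in> \<Union>C" "x \<noteq> y"
      then obtain Y Z where "Y \<in> C" "Z \<in> C" "x \<in> Y" "y \<in> Z" by blast
      with C(2)[of Y Z] obtain X where "X \<in> C" "x \<in> X" "y \<in> X" by blast
      with C(1) \<open>x \<noteq> y\<close> show "e \<le> dist x y"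
        by (auto simp: \<A>_def pairwise_def)
    qed
  qed
  then obtain S where S: "S \<in> \<A>" "\<And>X. X \<in> \<A> \<Longrightarrow> S \<subseteq> X \<Longrightarrow> X = S" by blast
  show thesis
  proof
    show "pairwise (\<lambda>x y. e \<le> dist x y) S" using S(1) by (simp add: \<A>_def)
    fix x
    show "\<exists>y\<in>S. dist x y < e"
    proof (rule ccontr)
      assume no: "\<not> (\<exists>y\<in>S. dist x y < e)"
      then have "insert x S \<in> \<A>"
        using S(1) by (auto simp: \<A>_def pairwise_insert dist_commute not_less)
      then have "insert x S = S" by (rule S(2)) auto
      then show False using no assms by (metis dist_self insertI1)
    qed
  qed
qed

text \<open>
  The balls of radius \<open>e / 2\<close> around the points of \<open>S\<close> are disjoint and of positive measure, and
  those centred in a fixed ball have finite total measure; a summable family of positive numbers is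
  countable.
\<close>

lemma countable_separated_set:
  fixes \<mu> :: "'a::metric_space measure"
  assumes mms: "metric_measure_space \<mu>" and "0 < e" and S: "pairwise (\<lambda>x y. e \<le> dist x y) (S :: 'a set)"
  shows "countable S"
proof -
  fix x0 :: 'a
  have ball_sets[simp]: "ball x r \<in> sets \<mu>" for x r
    by (rule mms_sets[OF mms]) auto
  have fin: "emeasure \<mu> (ball x r) \<noteq> \<infinity>" for x r
    using mms unfolding metric_measure_space_def
    by (cases "0 < r") (auto simp: less_top[symmetric] not_less ball_empty)
  have pos: "measure \<mu> (ball x r) \<noteq> 0" if "0 < r" for x r
  proof -
    have "0 < emeasure \<mu> (ball x r)"
      using mms that unfolding metric_measure_space_def by blast
    then show ?thesis using emeasure_eq_ennreal_measure[of \<mu> "ball x r"] fin[of x r] by auto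
  qed
  have "countable (S \<inter> ball x0 (real n))" for n
  proof -
    define T where "T = S \<inter> ball x0 (real n)"
    define m where "m x = measure \<mu> (ball x (e / 2))" for x
    have "m summable_on T"
    proof (rule nonneg_bdd_above_summable_on)
      show "bdd_above (sum m ` {F. F \<subseteq> T \<and> finite F})"
      proof (rule bdd_aboveI2)
        fix F assume "F \<in> {F. F \<subseteq> T \<and> finite F}"
        then have F: "F \<subseteq> T" "finite F" by auto
        have "disjoint_family_on (\<lambda>x. ball x (e / 2)) F"
          unfolding disjoint_family_on_def
        proof (intro ballI impI)
          fix x y assume xy: "x \<in> F" "y \<in> F" "x \<noteq> y"
          then have "e \<le> dist x y" using S F by (auto simp: pairwise_def T_def)
          then show "ball x (e / 2) \<inter> ball y (e / 2) = {}"
            by (intro disjoint_ballI) simp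
        qed
        then have "sum m F = measure \<mu> (\<Union>x\<in>F. ball x (e / 2))"
          unfolding m_def using F(2) fin by (intro measure_finite_Union[symmetric]) auto
        also have "\<dots> \<le> measure \<mu> (ball x0 (real n + e))"
        proof (rule measure_mono_fmeasurable)
          show "(\<Union>x\<in>F. ball x (e / 2)) \<subseteq> ball x0 (real n + e)"
          proof clarify
            fix x y assume "x \<in> F" "y \<in> ball x (e / 2)"
            then have "dist x0 x < real n" "dist x y < e / 2" using F by (auto simp: T_def)
            then show "y \<in> ball x0 (real n + e)"
              using dist_triangle[of x0 y x] \<open>0 < e\<close> by simp
          qed
          show "(\<Union>x\<in>F. ball x (e / 2)) \<in> sets \<mu>" using F(2) by (intro sets.finite_UN) auto
          show "ball x0 (real n + e) \<in> fmeasurable \<mu>"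
            using fin[of x0 "real n + e"] by (intro fmeasurableI) (auto simp: less_top)
        qed
        finally show "sum m F \<le> measure \<mu> (ball x0 (real n + e))" .
      qed
    qed (simp add: m_def)
    then have "countable {x \<in> T. m x \<noteq> 0}" by (rule summable_countable_real)
    moreover have "{x \<in> T. m x \<noteq> 0} = T" using pos \<open>0 < e\<close> by (auto simp: m_def)
    ultimately show ?thesis by (simp add: T_def)
  qed
  moreover have "S = (\<Union>n. S \<inter> ball x0 (real n))"
    using reals_Archimedean2 by auto
  ultimately show ?thesis by (metis countable_UN uncountable_def countableI_type)
qed

lemma mms_countable_dense:
  fixes \<mu> :: "'a::metric_space measure"
  assumes "metric_measure_space \<mu>"
  obtains D :: "'a set" where "countable D" "\<And>x e. 0 < e \<Longrightarrow> \<exists>d\<in>D. dist x d < e"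
proof -
  have "\<exists>S :: 'a set. pairwise (\<lambda>x y. 1 / real (Suc n) \<le> dist x y) S \<and> (\<forall>x. \<exists>y\<in>S. dist x y < 1 / real (Suc n))" for n
    using maximal_separated_set[of "1 / real (Suc n)"] by (metis of_nat_0_less_iff zero_less_Suc zero_less_divide_1_iff)
  then obtain S :: "nat \<Rightarrow> 'a set" where S: "\<And>n. pairwise (\<lambda>x y. 1 / real (Suc n) \<le> dist x y) (S n)"
    "\<And>n x. \<exists>y\<in>S n. dist x y < 1 / real (Suc n)" by metis
  have "countable (S n)" for n
    by (rule countable_separated_set[OF assms _ S(1)]) simp
  then have "countable (\<Union>n. S n)" by auto
  moreover have "\<exists>d\<in>(\<Union>n. S n). dist x d < e" if e: "0 < e" for x e
  proof -
    obtain n where n: "1 / real (Suc n) < e" using nat_approx_posE[OF e] by auto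
    obtain y where "y \<in> S n" "dist x y < 1 / real (Suc n)" using S(2) by blast
    with n show ?thesis by (intro bexI[of _ y]) auto
  qed
  ultimately show thesis by (rule that)
qed

text \<open>
  By separability, countably many balls on which \<open>g\<close> is in \<open>L\<^sup>p\<close> cover \<open>E\<close>.  Almost every curve has
  finite integral of \<open>g\<close> in all of these balls, and by compactness it is covered by finitely many.
\<close>

lemma ae_curve_finite_integral_loc:
  fixes \<mu> :: "'a::metric_space measure"
  assumes mms: "metric_measure_space \<mu>" and p: "0 < p" and E: "open E"
    and g: "g \<in> borel_measurable borel" and loc: "in_Lp_loc p \<mu> E g"
  shows "ae_curve p \<mu> E (\<lambda>\<gamma> l. curve_integral \<gamma> l g < \<infinity>)"
proof -
  have Eb[measurable]: "E \<in> sets borel" using E by auto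
  note [measurable] = g
  obtain D :: "'a set" where D: "countable D" "\<And>x e. 0 < e \<Longrightarrow> \<exists>d\<in>D. dist x d < e"
    using mms_countable_dense[OF mms] by blast
  define \<B> where "\<B> = {W \<in> (\<lambda>(d, q). ball d q) ` (D \<times> \<rat>). (\<integral>\<^sup>+y\<in>E \<inter> W. ennpowr (g y) p \<partial>\<mu>) < \<infinity>}"
  have "{} \<in> (\<lambda>(d, q). ball d q) ` (D \<times> \<rat>)"
  proof -
    obtain d where "d \<in> D" using D(2)[of 1 undefined] by auto
    then show ?thesis by (intro image_eqI[of _ _ "(d, 0)"]) auto
  qed
  then have ne: "{} \<in> \<B>" by (simp add: \<B>_def)
  have cnt: "countable \<B>" unfolding \<B>_def
    using D(1) countable_rat by (intro countable_Collect countable_image countable_SIGMA) auto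
  define c where "c = from_nat_into \<B>"
  have c: "range c = \<B>"
    unfolding c_def using ne cnt by (intro range_from_nat_into) auto
  have open_c: "open W" if "W \<in> \<B>" for W using that by (auto simp: \<B>_def)
  have cover: "E \<subseteq> \<Union>\<B>"
  proof
    fix x assume x: "x \<in> E"
    then obtain r where r: "0 < r" "(\<integral>\<^sup>+y\<in>E \<inter> ball x r. ennpowr (g y) p \<partial>\<mu>) < \<infinity>"
      using loc by (auto simp: in_Lp_loc_def)
    obtain d where d: "d \<in> D" "dist x d < r / 3" using D(2)[of "r / 3" x] r(1) by auto
    obtain q where q: "q \<in> \<rat>" "r / 3 < q" "q < r / 2"
      using Rats_dense_in_real[of "r / 3" "r / 2"] r(1) by auto
    have sub: "ball d q \<subseteq> ball x r"
    proof
      fix y assume "y \<in> ball d q"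
      then show "y \<in> ball x r"
        using d q dist_triangle[of x y d] by simp
    qed
    have "(\<integral>\<^sup>+y\<in>E \<inter> ball d q. ennpowr (g y) p \<partial>\<mu>) \<le> (\<integral>\<^sup>+y\<in>E \<inter> ball x r. ennpowr (g y) p \<partial>\<mu>)"
      using sub by (intro nn_integral_mono) (auto split: split_indicator)
    then have "ball d q \<in> \<B>"
      using d q r(2) by (auto simp: \<B>_def intro!: image_eqI[of _ _ "(d, q)"] intro: order.strict_trans1)
    moreover have "x \<in> ball d q" using d q by (simp add: dist_commute)
    ultimately show "x \<in> \<Union>\<B>" by blast
  qed
  have "ae_curve p \<mu> E (\<lambda>\<gamma> l. \<forall>n. curve_integral \<gamma> l (\<lambda>x. g x * indicator (c n) x) < \<infinity>)"
  proof (rule ae_curve_all[OF mms p Eb], rule ae_curve_finite_integral)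
    fix n
    have [measurable]: "c n \<in> sets borel" using c open_c by auto
    show "(\<lambda>x. g x * indicator (c n) x) \<in> borel_measurable borel" by measurable
    have "(\<integral>\<^sup>+x\<in>E. ennpowr (g x * indicator (c n) x) p \<partial>\<mu>) = (\<integral>\<^sup>+x\<in>E \<inter> c n. ennpowr (g x) p \<partial>\<mu>)"
      by (intro nn_integral_cong) (auto split: split_indicator)
    also have "\<dots> < \<infinity>" using c by (auto simp: \<B>_def)
    finally show "(\<integral>\<^sup>+x\<in>E. ennpowr (g x * indicator (c n) x) p \<partial>\<mu>) < \<infinity>" .
  qed
  then show ?thesis
  proof (rule ae_curve_mono)
    fix \<gamma> l assume \<gamma>: "arc_curve E \<gamma> l"
      and fin: "\<forall>n. curve_integral \<gamma> l (\<lambda>x. g x * indicator (c n) x) < \<infinity>"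
    have cont: "continuous_on {0..l} \<gamma>" and "\<gamma> ` {0..l} \<subseteq> E" using \<gamma> by (auto simp: arc_curve_def)
    have "compact (\<gamma> ` {0..l})" by (rule compact_continuous_image[OF cont compact_Icc])
    then obtain F where F: "F \<subseteq> \<B>" "finite F" "\<gamma> ` {0..l} \<subseteq> \<Union>F"
    proof (rule compactE)
      show "\<gamma> ` {0..l} \<subseteq> \<Union>\<B>" using \<open>\<gamma> ` {0..l} \<subseteq> E\<close> cover by (rule order_trans)
    qed (use open_c in auto)
    have "curve_integral \<gamma> l g \<le> (\<integral>\<^sup>+t. (\<Sum>W\<in>F. g (\<gamma> t) * indicator W (\<gamma> t) * indicator {0..l} t) \<partial>lborel)"
      unfolding curve_integral_lborel
    proof (rule nn_integral_mono)
      fix t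
      show "g (\<gamma> t) * indicator {0..l} t \<le> (\<Sum>W\<in>F. g (\<gamma> t) * indicator W (\<gamma> t) * indicator {0..l} t)"
      proof (cases "t \<in> {0..l}")
        case True
        then obtain W where W: "W \<in> F" "\<gamma> t \<in> W" using F(3) by blast
        have "g (\<gamma> t) * indicator {0..l} t = g (\<gamma> t) * indicator W (\<gamma> t) * indicator {0..l} t"
          using W by simp
        also have "\<dots> \<le> (\<Sum>W\<in>F. g (\<gamma> t) * indicator W (\<gamma> t) * indicator {0..l} t)"
          by (rule member_le_sum[OF W(1)]) (use F(2) in auto)
        finally show ?thesis .
      qed simp
    qed
    also have "\<dots> = (\<Sum>W\<in>F. curve_integral \<gamma> l (\<lambda>x. g x * indicator W x))"
      unfolding curve_integral_lborel
    proof (rule nn_integral_sum)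
      fix W assume "W \<in> F"
      then have [measurable]: "W \<in> sets borel" using F(1) open_c by auto
      have "(\<lambda>x. g x * indicator W x) \<in> borel_measurable borel" by measurable
      from borel_measurable_along_curve[OF this cont]
      show "(\<lambda>t. g (\<gamma> t) * indicator W (\<gamma> t) * indicator {0..l} t) \<in> borel_measurable lborel" by simp
    qed
    also have "\<dots> < \<infinity>"
    proof -
      have "curve_integral \<gamma> l (\<lambda>x. g x * indicator W x) < \<infinity>" if W: "W \<in> F" for W
      proof -
        obtain n where "W = c n" using W F(1) c by blast
        then show ?thesis using fin by simp
      qed
      then show ?thesis using F(2) by (simp add: ennreal_sum_less_top)
    qed
    finally show "curve_integral \<gamma> l g < \<infinity>" .
  qed
qed

section \<open>Weak upper gradients\<close>

lemma ediff_ereal: "ediff (ereal a) (ereal b) = ennreal \<bar>a - b\<bar>"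
  by (simp add: ediff_def e2ennreal_ereal)

lemma ae_curve_subset:
  assumes "ae_curve p \<mu> E P" "E' \<subseteq> E" "E \<in> sets borel"
  shows "ae_curve p \<mu> E' P"
proof -
  obtain \<rho> where \<rho>: "\<rho> \<in> borel_measurable borel" "(\<integral>\<^sup>+x. ennpowr (\<rho> x) p \<partial>\<mu>) < \<infinity>"
    "\<And>\<gamma> l. arc_curve E \<gamma> l \<Longrightarrow> \<not> P \<gamma> l \<Longrightarrow> curve_integral \<gamma> l \<rho> = \<infinity>"
    using ae_curveE[OF assms(1,3)] by blast
  show ?thesis
  proof (rule ae_curveI[OF \<rho>(1)])
    have "(\<integral>\<^sup>+x\<in>E'. ennpowr (\<rho> x) p \<partial>\<mu>) \<le> (\<integral>\<^sup>+x. ennpowr (\<rho> x) p \<partial>\<mu>)"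
      by (intro nn_integral_mono) (auto split: split_indicator)
    then show "(\<integral>\<^sup>+x\<in>E'. ennpowr (\<rho> x) p \<partial>\<mu>) < \<infinity>"
      using \<rho>(2) by (rule order.strict_trans1)
    fix \<gamma> l assume "arc_curve E' \<gamma> l" and fin: "curve_integral \<gamma> l \<rho> < \<infinity>"
    then have "arc_curve E \<gamma> l" using assms(2) by (auto simp: arc_curve_def)
    then show "P \<gamma> l" using \<rho>(3)[of \<gamma> l] fin by (cases "P \<gamma> l") auto
  qed
qed

lemma restrict_space_measurable_subset:
  assumes "metric_measure_space \<mu>" "f \<in> borel_measurable (restrict_space \<mu> E)" "E' \<subseteq> E"
    "E \<in> sets borel" "E' \<in> sets borel"
  shows "f \<in> borel_measurable (restrict_space \<mu> E')"
proof -
  have "restrict_space \<mu> E' = restrict_space (restrict_space \<mu> E) E'"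
    using assms mms_sets[OF assms(1)] mms_space[OF assms(1)]
    by (subst restrict_restrict_space) (auto simp: inf.absorb2)
  then show ?thesis using assms(2) by (simp add: measurable_restrict_space1)
qed

lemma weak_upper_gradient_subset:
  assumes "metric_measure_space \<mu>" "weak_upper_gradient p \<mu> E u g" "E' \<subseteq> E"
    "E \<in> sets borel" "E' \<in> sets borel"
  shows "weak_upper_gradient p \<mu> E' u g"
  using assms ae_curve_subset[of p \<mu> E _ E'] restrict_space_measurable_subset[of \<mu> g E E']
  unfolding weak_upper_gradient_def by blast

text \<open>
  Changing \<open>g\<close> on a null set does not matter, because almost every curve spends no time there.  This
  allows a measurable gradient to be replaced by a Borel one, whose line integrals are well behaved.
\<close>

lemma weak_upper_gradient_mono_AE:
  assumes mms: "metric_measure_space \<mu>" and p: "0 < p" and E: "E \<in> sets borel"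
    and g: "weak_upper_gradient p \<mu> E u g" and g': "g' \<in> borel_measurable (restrict_space \<mu> E)"
    and le: "AE x in \<mu>. x \<in> E \<longrightarrow> g x \<le> g' x"
  shows "weak_upper_gradient p \<mu> E u g'"
  unfolding weak_upper_gradient_def
proof
  have "ae_curve p \<mu> E (\<lambda>\<gamma> l. ediff (u (\<gamma> 0)) (u (\<gamma> l)) \<le> curve_integral \<gamma> l g \<and>
      (AE t in lborel. t \<in> {0..l} \<longrightarrow> g (\<gamma> t) \<le> g' (\<gamma> t)))"
    using g ae_curve_AE[OF mms p le]
    by (intro ae_curve_conj[OF mms p E]) (simp_all add: weak_upper_gradient_def)
  then show "ae_curve p \<mu> E (\<lambda>\<gamma> l. ediff (u (\<gamma> 0)) (u (\<gamma> l)) \<le> curve_integral \<gamma> l g')"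
  proof (rule ae_curve_mono, elim conjE)
    fix \<gamma> l
    assume "ediff (u (\<gamma> 0)) (u (\<gamma> l)) \<le> curve_integral \<gamma> l g"
      and ae: "AE t in lborel. t \<in> {0..l} \<longrightarrow> g (\<gamma> t) \<le> g' (\<gamma> t)"
    note this(1)
    also have "curve_integral \<gamma> l g \<le> curve_integral \<gamma> l g'"
      unfolding curve_integral_lborel
      using ae by (intro nn_integral_mono_AE) (auto elim!: eventually_mono split: split_indicator)
    finally show "ediff (u (\<gamma> 0)) (u (\<gamma> l)) \<le> curve_integral \<gamma> l g'" .
  qed
qed (fact g')

lemma weak_upper_gradient_on_subcurves:
  assumes g: "weak_upper_gradient p \<mu> E' (\<lambda>x. ereal (v x)) g" "g \<in> borel_measurable borel"
    and E': "E' \<in> sets borel"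
  shows "ae_curve p \<mu> E (\<lambda>\<gamma> l. \<forall>s t. 0 \<le> s \<and> s \<le> t \<and> t \<le> l \<and> \<gamma> ` {s..t} \<subseteq> E' \<longrightarrow>
    ennreal \<bar>v (\<gamma> s) - v (\<gamma> t)\<bar> \<le> (\<integral>\<^sup>+\<tau>\<in>{s..t}. g (\<gamma> \<tau>) \<partial>lborel))"
proof (rule ae_curve_mono)
  show "ae_curve p \<mu> E (\<lambda>\<gamma> l. \<forall>s t. 0 \<le> s \<and> s < t \<and> t \<le> l \<and> \<gamma> ` {s..t} \<subseteq> E' \<longrightarrow>
    ediff (ereal (v (\<gamma> (s + 0)))) (ereal (v (\<gamma> (s + (t - s))))) \<le> curve_integral (\<lambda>\<tau>. \<gamma> (s + \<tau>)) (t - s) g)"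
    by (rule ae_curve_subcurves[OF _ E']) (use g(1) in \<open>simp add: weak_upper_gradient_def\<close>)
  fix \<gamma> :: "real \<Rightarrow> 'a" and l
  assume \<gamma>: "arc_curve E \<gamma> l" and *: "\<forall>s t. 0 \<le> s \<and> s < t \<and> t \<le> l \<and> \<gamma> ` {s..t} \<subseteq> E' \<longrightarrow>
    ediff (ereal (v (\<gamma> (s + 0)))) (ereal (v (\<gamma> (s + (t - s))))) \<le> curve_integral (\<lambda>\<tau>. \<gamma> (s + \<tau>)) (t - s) g"
  show "\<forall>s t. 0 \<le> s \<and> s \<le> t \<and> t \<le> l \<and> \<gamma> ` {s..t} \<subseteq> E' \<longrightarrow>
    ennreal \<bar>v (\<gamma> s) - v (\<gamma> t)\<bar> \<le> (\<integral>\<^sup>+\<tau>\<in>{s..t}. g (\<gamma> \<tau>) \<partial>lborel)"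
  proof (intro allI impI, elim conjE)
    fix s t assume st: "0 \<le> s" "s \<le> t" "t \<le> l" "\<gamma> ` {s..t} \<subseteq> E'"
    show "ennreal \<bar>v (\<gamma> s) - v (\<gamma> t)\<bar> \<le> (\<integral>\<^sup>+\<tau>\<in>{s..t}. g (\<gamma> \<tau>) \<partial>lborel)"
    proof (cases "s = t")
      case False
      with st have "s < t" by simp
      have "continuous_on {0..l} \<gamma>" using \<gamma> by (simp add: arc_curve_def)
      from curve_integral_subcurve[OF g(2) this st(1,3)] show ?thesis
        using *[rule_format, of s t] st \<open>s < t\<close> by (simp add: ediff_ereal)
    qed simp
  qed
qed

text \<open>
  Gradients \<open>g n\<close> known on open sets \<open>U n\<close> combine to the smallest of those available at each
  point.  On almost every curve this is the statement on increments along an interval; the covering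
  hypothesis provides on each curve one gradient with which to start.
\<close>

lemma weak_upper_gradient_INF:
  fixes E :: "'a::metric_space set" and U :: "nat \<Rightarrow> 'a set"
  assumes mms: "metric_measure_space \<mu>" and p: "0 < p" and E: "E \<in> sets borel"
    and U: "\<And>n. open (U n)"
    and meas[measurable]: "\<And>n. g n \<in> borel_measurable borel"
    and wug: "\<And>n. weak_upper_gradient p \<mu> (U n) (\<lambda>x. ereal (v x)) (g n)"
    and fin: "\<And>n. ae_curve p \<mu> E (\<lambda>\<gamma> l. curve_integral \<gamma> l (\<lambda>x. g n x * indicator (U n) x) < \<infinity>)"
    and cover: "\<And>\<gamma> l. arc_curve E \<gamma> l \<Longrightarrow> \<exists>n. \<gamma> ` {0..l} \<subseteq> U n"
  shows "(\<lambda>x. INF n\<in>{n. x \<in> U n}. g n x) \<in> borel_measurable borel"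
    and "weak_upper_gradient p \<mu> E (\<lambda>x. ereal (v x)) (\<lambda>x. INF n\<in>{n. x \<in> U n}. g n x)"
proof -
  have [measurable]: "U n \<in> sets borel" for n using U by auto
  have eq: "(INF n\<in>{n. x \<in> U n}. g n x) = (INF n. if x \<in> U n then g n x else \<infinity>)" for x
  proof (rule antisym)
    show "(INF n\<in>{n. x \<in> U n}. g n x) \<le> (INF n. if x \<in> U n then g n x else \<infinity>)"
    proof (rule INF_greatest)
      fix n
      show "(INF n\<in>{n. x \<in> U n}. g n x) \<le> (if x \<in> U n then g n x else \<infinity>)"
        by (cases "x \<in> U n") (auto intro: INF_lower)
    qed
    show "(INF n. if x \<in> U n then g n x else \<infinity>) \<le> (INF n\<in>{n. x \<in> U n}. g n x)"
    proof (rule INF_greatest)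
      fix n assume "n \<in> {n. x \<in> U n}"
      then show "(INF n. if x \<in> U n then g n x else \<infinity>) \<le> g n x"
        by (intro INF_lower2[of n]) auto
    qed
  qed
  then show meas': "(\<lambda>x. INF n\<in>{n. x \<in> U n}. g n x) \<in> borel_measurable borel"
    unfolding eq by (intro borel_measurable_INF) auto
  show "weak_upper_gradient p \<mu> E (\<lambda>x. ereal (v x)) (\<lambda>x. INF n\<in>{n. x \<in> U n}. g n x)"
    unfolding weak_upper_gradient_def
  proof
    show "(\<lambda>x. INF n\<in>{n. x \<in> U n}. g n x) \<in> borel_measurable (restrict_space \<mu> E)"
      by (intro measurable_restrict_space1 mms_measurable[OF mms] meas')
    have "ae_curve p \<mu> E (\<lambda>\<gamma> l. (\<forall>n. curve_integral \<gamma> l (\<lambda>x. g n x * indicator (U n) x) < \<infinity>) \<and>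
      (\<forall>n. \<forall>s t. 0 \<le> s \<and> s \<le> t \<and> t \<le> l \<and> \<gamma> ` {s..t} \<subseteq> U n \<longrightarrow>
        ennreal \<bar>v (\<gamma> s) - v (\<gamma> t)\<bar> \<le> (\<integral>\<^sup>+\<tau>\<in>{s..t}. g n (\<gamma> \<tau>) \<partial>lborel)))"
      by (intro ae_curve_conj[OF mms p E] ae_curve_all[OF mms p E] fin
          weak_upper_gradient_on_subcurves wug meas) auto
    then show "ae_curve p \<mu> E (\<lambda>\<gamma> l. ediff (ereal (v (\<gamma> 0))) (ereal (v (\<gamma> l)))
        \<le> curve_integral \<gamma> l (\<lambda>x. INF n\<in>{n. x \<in> U n}. g n x))"
    proof (rule ae_curve_mono, elim conjE)
      fix \<gamma> l assume \<gamma>: "arc_curve E \<gamma> l"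
        and finite: "\<forall>n. curve_integral \<gamma> l (\<lambda>x. g n x * indicator (U n) x) < \<infinity>"
        and bound: "\<forall>n. \<forall>s t. 0 \<le> s \<and> s \<le> t \<and> t \<le> l \<and> \<gamma> ` {s..t} \<subseteq> U n \<longrightarrow>
          ennreal \<bar>v (\<gamma> s) - v (\<gamma> t)\<bar> \<le> (\<integral>\<^sup>+\<tau>\<in>{s..t}. g n (\<gamma> \<tau>) \<partial>lborel)"
      have cont: "continuous_on {0..l} \<gamma>" and l: "0 < l" using \<gamma> by (auto simp: arc_curve_def)
      \<comment> \<open>Preimages under \<open>\<gamma>\<close> are only relatively open in \<open>{0..l}\<close>; \<open>T n\<close> is open on the line.\<close>
      have "\<exists>A. open A \<and> A \<inter> {0..l} = \<gamma> -` U n \<inter> {0..l}" for n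
        using cont U unfolding continuous_on_open_invariant by blast
      then obtain T where T: "\<And>n. open (T n)" "\<And>n. T n \<inter> {0..l} = \<gamma> -` U n \<inter> {0..l}"
        by metis
      have T_iff: "t \<in> T n \<longleftrightarrow> \<gamma> t \<in> U n" if "t \<in> {0..l}" for t n using T(2)[of n] that by blast
      define f where "f n t = g n (\<gamma> t) * indicator {0..l} t" for n t
      obtain N where N: "\<gamma> ` {0..l} \<subseteq> U N" using cover[OF \<gamma>] by blast
      have "increments_bounded (\<lambda>t. v (\<gamma> t)) 0 l UNIV (\<lambda>t. INF n\<in>{n. t \<in> T n}. f n t)"
      proof (rule increments_bounded_INF)
        show "f n \<in> borel_measurable borel" for n
          unfolding f_def by (rule borel_measurable_along_curve[OF meas cont])
        show "(\<integral>\<^sup>+x\<in>{0..l} \<inter> T n. f n x \<partial>lborel) < \<infinity>" for n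
        proof -
          have "(\<integral>\<^sup>+x\<in>{0..l} \<inter> T n. f n x \<partial>lborel) = curve_integral \<gamma> l (\<lambda>x. g n x * indicator (U n) x)"
            unfolding curve_integral_lborel f_def
            using T_iff by (intro nn_integral_cong) (auto split: split_indicator)
          then show ?thesis using finite by simp
        qed
        show "increments_bounded (\<lambda>t. v (\<gamma> t)) 0 l (T n) (f n)" for n
          unfolding increments_bounded_def
        proof (intro allI impI, elim conjE)
          fix s t assume st: "0 \<le> s" "s \<le> t" "t \<le> l" "{s..t} \<subseteq> T n"
          have "\<gamma> ` {s..t} \<subseteq> U n" using st T_iff by fastforce
          with bound st have "ennreal \<bar>v (\<gamma> s) - v (\<gamma> t)\<bar> \<le> (\<integral>\<^sup>+\<tau>\<in>{s..t}. g n (\<gamma> \<tau>) \<partial>lborel)"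
            by blast
          also have "\<dots> = (\<integral>\<^sup>+\<tau>\<in>{s..t}. f n \<tau> \<partial>lborel)"
            using st by (intro nn_integral_cong) (auto simp: f_def split: split_indicator)
          finally show "ennreal \<bar>v (\<gamma> s) - v (\<gamma> t)\<bar> \<le> (\<integral>\<^sup>+\<tau>\<in>{s..t}. f n \<tau> \<partial>lborel)" .
        qed
        show "{0..l} \<subseteq> T N" using N T_iff by blast
      qed (rule T(1))
      from increments_boundedD[OF this, of 0 l]
      have "ennreal \<bar>v (\<gamma> 0) - v (\<gamma> l)\<bar> \<le> (\<integral>\<^sup>+t\<in>{0..l}. (INF n\<in>{n. t \<in> T n}. f n t) \<partial>lborel)"
        using l by simp
      also have "\<dots> = curve_integral \<gamma> l (\<lambda>x. INF n\<in>{n. x \<in> U n}. g n x)"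
        unfolding curve_integral_lborel
        using T_iff by (intro nn_integral_cong) (auto simp: f_def split: split_indicator)
      finally show "ediff (ereal (v (\<gamma> 0))) (ereal (v (\<gamma> l)))
        \<le> curve_integral \<gamma> l (\<lambda>x. INF n\<in>{n. x \<in> U n}. g n x)"
        by (simp add: ediff_ereal)
    qed
  qed
qed

section \<open>Existence of minimal weak upper gradients\<close>

lemma ennreal_inverse_antimono: "a \<le> b \<Longrightarrow> inverse b \<le> inverse (a :: ennreal)"
  including ennreal.lifting
  by transfer (rule ereal_inverse_antimono)

lemma ennreal_inverse_inverse: "inverse (inverse x) = (x :: ennreal)"
proof (cases x)
  case (real r)
  then show ?thesis by (cases "r = 0") (simp_all add: inverse_ennreal)
qed simp

text \<open>
  The functional \<open>S g = \<integral> w / (1 + g)\<close>, with \<open>w\<close> a positive integrable weight, is bounded and strictly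
  decreasing in \<open>g\<close> modulo null sets.  The infimum \<open>g\<close> of a maximizing sequence attains the maximum,
  and so does its minimum with any other \<open>h\<close>; hence that minimum equals \<open>g\<close> almost everywhere.
\<close>

lemma essential_infimum:
  fixes G :: "('a \<Rightarrow> ennreal) set"
  assumes "sigma_finite_measure M" and ne: "G \<noteq> {}"
    and meas: "\<And>g. g \<in> G \<Longrightarrow> g \<in> borel_measurable M"
    and INF_closed: "\<And>s :: nat \<Rightarrow> 'a \<Rightarrow> ennreal. (\<And>n. s n \<in> G) \<Longrightarrow> (\<lambda>x. INF n. s n x) \<in> G"
  shows "\<exists>g\<in>G. \<forall>h\<in>G. AE x in M. g x \<le> h x"
proof -
  obtain w where w[measurable]: "w \<in> borel_measurable M" and w_fin: "(\<integral>\<^sup>+x. w x \<partial>M) \<noteq> \<infinity>"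
    and w_pos: "\<And>x. x \<in> space M \<Longrightarrow> 0 < w x \<and> w x < \<infinity>"
    using sigma_finite_measure.Ex_finite_integrable_function[OF assms(1)] by blast
  define S where "S g = (\<integral>\<^sup>+x. inverse (1 + g x) * w x \<partial>M)" for g :: "'a \<Rightarrow> ennreal"
  obtain f :: "nat \<Rightarrow> ennreal" where f: "range f \<subseteq> S ` G" "(SUP g\<in>G. S g) = (SUP n. f n)"
    using ennreal_SUP_countable_SUP[OF ne, of S] by auto
  have "\<exists>g\<in>G. f n = S g" for n using f(1) by blast
  then obtain s where s: "\<And>n. s n \<in> G" "\<And>n. f n = S (s n)" by metis
  define g where "g x = (INF n. s n x)" for x
  have g: "g \<in> G" unfolding g_def by (rule INF_closed) (rule s)
  note [measurable] = meas[OF g]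
  have S_anti: "S h' \<le> S h" if "\<And>x. h x \<le> h' x" for h h'
    unfolding S_def using that
    by (intro nn_integral_mono mult_right_mono) (auto intro!: ennreal_inverse_antimono add_left_mono)
  have S_max: "S h \<le> S g" if "h \<in> G" for h
  proof -
    have "S h \<le> (SUP n. S (s n))" using f(2) s(2) SUP_upper[OF that, of S] by simp
    also have "\<dots> \<le> S g" by (intro SUP_least S_anti) (auto simp: g_def intro: INF_lower)
    finally show ?thesis .
  qed
  show ?thesis
  proof (intro bexI[OF _ g] ballI)
    fix h assume h: "h \<in> G"
    define m where "m x = min (g x) (h x)" for x
    \<comment> \<open>A binary minimum is the infimum of a sequence that is constant after its first term.\<close>
    have "(\<lambda>x. INF n::nat. if n = 0 then g x else h x) \<in> G"
    proof (rule INF_closed)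
      show "(\<lambda>x. if n = 0 then g x else h x) \<in> G" for n :: nat
        using g h by (cases "n = 0") simp_all
    qed
    moreover have "(INF n::nat. if n = 0 then g x else h x) = m x" for x
    proof (rule antisym)
      have "(INF n::nat. if n = 0 then g x else h x) \<le> (if (0::nat) = 0 then g x else h x)"
        by (rule INF_lower) simp
      moreover have "(INF n::nat. if n = 0 then g x else h x) \<le> (if (1::nat) = 0 then g x else h x)"
        by (rule INF_lower) simp
      ultimately show "(INF n::nat. if n = 0 then g x else h x) \<le> m x" by (simp add: m_def)
      show "m x \<le> (INF n::nat. if n = 0 then g x else h x)"
        by (rule INF_greatest) (simp add: m_def)
    qed
    ultimately have m: "m \<in> G" by simp
    note [measurable] = meas[OF m]
    have m_le: "m x \<le> g x" for x by (simp add: m_def)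
    have fin: "S g \<noteq> \<infinity>"
    proof -
      have "S g \<le> (\<integral>\<^sup>+x. 1 * w x \<partial>M)"
        unfolding S_def
      proof (intro nn_integral_mono mult_right_mono)
        fix x
        have "inverse (1 + g x) \<le> inverse 1" by (rule ennreal_inverse_antimono) auto
        then show "inverse (1 + g x) \<le> 1" by simp
      qed simp
      then show ?thesis using w_fin by (auto simp: top_unique)
    qed
    have "AE x in M. inverse (1 + m x) * w x \<le> inverse (1 + g x) * w x"
    proof (rule ccontr)
      assume "\<not> (AE x in M. inverse (1 + m x) * w x \<le> inverse (1 + g x) * w x)"
      then have "S g < S m"
        unfolding S_def using fin
        by (intro nn_integral_less)
           (auto simp: S_def m_le intro!: mult_right_mono ennreal_inverse_antimono add_left_mono)
      with S_max[OF m] show False by simp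
    qed
    then show "AE x in M. g x \<le> h x"
    proof (rule AE_mp, intro AE_I2 impI)
      fix x assume x: "x \<in> space M" and le: "inverse (1 + m x) * w x \<le> inverse (1 + g x) * w x"
      have "inverse (1 + m x) \<le> inverse (1 + g x)"
        using le w_pos[OF x]
          ennreal_mult_le_mult_iff[of "w x" "inverse (1 + m x)" "inverse (1 + g x)"]
        by (auto simp: mult.commute[of _ "w x"] less_top[symmetric])
      then have "inverse (inverse (1 + g x)) \<le> inverse (inverse (1 + m x))"
        by (rule ennreal_inverse_antimono)
      then have "1 + g x \<le> 1 + m x" by (simp add: ennreal_inverse_inverse)
      then have "g x \<le> m x" by (simp add: ennreal_add_left_cancel_le)
      then show "g x \<le> h x" by (simp add: m_def)
    qed
  qed
qed

lemma mms_sigma_finite: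
  fixes \<mu> :: "'a::metric_space measure"
  assumes mms: "metric_measure_space \<mu>"
  shows "sigma_finite_measure \<mu>"
proof
  fix x0 :: 'a
  show "\<exists>A. countable A \<and> A \<subseteq> sets \<mu> \<and> \<Union>A = space \<mu> \<and> (\<forall>a\<in>A. emeasure \<mu> a \<noteq> \<infinity>)"
  proof (intro exI[of _ "range (\<lambda>n. ball x0 (real (Suc n)))"] conjI)
    show "range (\<lambda>n. ball x0 (real (Suc n))) \<subseteq> sets \<mu>"
      by (auto intro!: mms_sets[OF mms])
    have "x \<in> (\<Union>n. ball x0 (real (Suc n)))" for x
    proof -
      obtain n where "dist x0 x < real n" using reals_Archimedean2 by blast
      then show ?thesis by (auto intro!: exI[of _ n])
    qed
    then show "\<Union>(range (\<lambda>n. ball x0 (real (Suc n)))) = space \<mu>"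
      using mms_space[OF mms] by blast
    show "\<forall>a\<in>range (\<lambda>n. ball x0 (real (Suc n))). emeasure \<mu> a \<noteq> \<infinity>"
    proof clarify
      fix n assume "emeasure \<mu> (ball x0 (real (Suc n))) = \<infinity>"
      moreover have "emeasure \<mu> (ball x0 (real (Suc n))) < \<infinity>"
        using mms unfolding metric_measure_space_def by (metis of_nat_0_less_iff zero_less_Suc)
      ultimately show False by simp
    qed
  qed auto
qed

lemma in_Lp_loc_mono_AE:
  assumes g: "in_Lp_loc p \<mu> E g" and p: "0 \<le> p" and g': "g' \<in> borel_measurable (restrict_space \<mu> E)"
    and le: "AE x in \<mu>. x \<in> E \<longrightarrow> g' x \<le> g x"
  shows "in_Lp_loc p \<mu> E g'"
  unfolding in_Lp_loc_def
proof (intro conjI ballI g')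
  fix x assume "x \<in> E"
  then obtain r where r: "0 < r" "(\<integral>\<^sup>+y\<in>E \<inter> ball x r. ennpowr (g y) p \<partial>\<mu>) < \<infinity>"
    using g by (auto simp: in_Lp_loc_def)
  have "(\<integral>\<^sup>+y\<in>E \<inter> ball x r. ennpowr (g' y) p \<partial>\<mu>) \<le> (\<integral>\<^sup>+y\<in>E \<inter> ball x r. ennpowr (g y) p \<partial>\<mu>)"
    using le p
    by (intro nn_integral_mono_AE) (auto elim!: eventually_mono intro!: ennpowr_mono split: split_indicator)
  with r show "\<exists>r>0. (\<integral>\<^sup>+y\<in>E \<inter> ball x r. ennpowr (g' y) p \<partial>\<mu>) < \<infinity>"
    by (auto intro: order.strict_trans1)
qed

text \<open>
  Gluing of gradients that are only measurable: pass to Borel versions and obtain finiteness along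
  curves from local integrability.
\<close>

lemma weak_upper_gradient_INF_loc:
  fixes E :: "'a::metric_space set" and U :: "nat \<Rightarrow> 'a set"
  assumes mms: "metric_measure_space \<mu>" and p: "0 < p" and E: "open E"
    and U: "\<And>n. open (U n)" "\<And>n. U n \<subseteq> E"
    and wug: "\<And>n. weak_upper_gradient p \<mu> (U n) (\<lambda>x. ereal (v x)) (g n)"
    and loc: "\<And>n. in_Lp_loc p \<mu> E (\<lambda>x. g n x * indicator (U n) x)"
    and cover: "\<And>\<gamma> l. arc_curve E \<gamma> l \<Longrightarrow> \<exists>n. \<gamma> ` {0..l} \<subseteq> U n"
  shows "weak_upper_gradient p \<mu> E (\<lambda>x. ereal (v x)) (\<lambda>x. INF n\<in>{n. x \<in> U n}. g n x)"
proof -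
  have Eb: "E \<in> sets borel" and Ub[measurable]: "\<And>n. U n \<in> sets borel" using E U by auto
  have "\<exists>h. h \<in> borel_measurable borel \<and> (AE x in \<mu>. x \<in> U n \<longrightarrow> g n x = h x)" for n
    using mms_borel_version[OF mms Ub, of "g n" n] wug[of n]
    unfolding weak_upper_gradient_def by blast
  then obtain h where h[measurable]: "\<And>n. h n \<in> borel_measurable borel"
    and gh: "\<And>n. AE x in \<mu>. x \<in> U n \<longrightarrow> g n x = h n x" by metis
  have hb: "f \<in> borel_measurable (restrict_space \<mu> A)" if "f \<in> borel_measurable borel" for f :: "'a \<Rightarrow> ennreal" and A
    by (intro measurable_restrict_space1 mms_measurable[OF mms] that)
  have wug_h: "weak_upper_gradient p \<mu> (U n) (\<lambda>x. ereal (v x)) (h n)" for n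
    by (rule weak_upper_gradient_mono_AE[OF mms p Ub wug hb[OF h]])
       (use gh[of n] in \<open>auto elim: eventually_mono\<close>)
  have fin: "ae_curve p \<mu> E (\<lambda>\<gamma> l. curve_integral \<gamma> l (\<lambda>x. h n x * indicator (U n) x) < \<infinity>)" for n
  proof (rule ae_curve_finite_integral_loc[OF mms p E])
    show *: "(\<lambda>x. h n x * indicator (U n) x) \<in> borel_measurable borel" by measurable
    show "in_Lp_loc p \<mu> E (\<lambda>x. h n x * indicator (U n) x)"
      by (rule in_Lp_loc_mono_AE[OF loc[of n] _ hb[OF *]])
         (use gh[of n] p in \<open>auto elim!: eventually_mono split: split_indicator\<close>)
  qed
  note hI = weak_upper_gradient_INF[OF mms p Eb U(1) h wug_h fin cover]
  have eq: "(INF n\<in>{n. x \<in> U n}. g n x) = (INF n. if x \<in> U n then g n x * indicator (U n) x else \<infinity>)" for x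
  proof (rule antisym)
    show "(INF n\<in>{n. x \<in> U n}. g n x) \<le> (INF n. if x \<in> U n then g n x * indicator (U n) x else \<infinity>)"
    proof (rule INF_greatest)
      fix n
      show "(INF n\<in>{n. x \<in> U n}. g n x) \<le> (if x \<in> U n then g n x * indicator (U n) x else \<infinity>)"
        by (cases "x \<in> U n") (auto intro: INF_lower)
    qed
    show "(INF n. if x \<in> U n then g n x * indicator (U n) x else \<infinity>) \<le> (INF n\<in>{n. x \<in> U n}. g n x)"
    proof (rule INF_greatest)
      fix n assume "n \<in> {n. x \<in> U n}"
      then show "(INF n. if x \<in> U n then g n x * indicator (U n) x else \<infinity>) \<le> g n x"
        by (intro INF_lower2[of n]) auto
    qed
  qed
  show ?thesis
  proof (rule weak_upper_gradient_mono_AE[OF mms p Eb hI(2)])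
    have [measurable]: "(\<lambda>x. g n x * indicator (U n) x) \<in> borel_measurable (restrict_space \<mu> E)" for n
      using loc[of n] by (simp add: in_Lp_loc_def)
    have [measurable]: "Measurable.pred (restrict_space \<mu> E) (\<lambda>x. x \<in> U n)" for n
      by (intro measurable_restrict_space1 mms_measurable[OF mms]) measurable
    show "(\<lambda>x. INF n\<in>{n. x \<in> U n}. g n x) \<in> borel_measurable (restrict_space \<mu> E)"
      unfolding eq by measurable
    have "AE x in \<mu>. \<forall>n. x \<in> U n \<longrightarrow> g n x = h n x"
      using gh by (simp add: AE_all_countable)
    then show "AE x in \<mu>. x \<in> E \<longrightarrow> (INF n\<in>{n. x \<in> U n}. h n x) \<le> (INF n\<in>{n. x \<in> U n}. g n x)"
      by eventually_elim (auto intro!: INF_mono)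
  qed
qed

text \<open>
  Weak upper gradients in \<open>L\<^sup>p\<^sub>l\<^sub>o\<^sub>c\<close> are closed under countable infima, so the essential infimum of
  this family is itself a member.
\<close>

lemma is_minimal_wug_minimal_wug:
  fixes E :: "'a::metric_space set"
  assumes mms: "metric_measure_space \<mu>" and p: "0 < p" and E: "open E"
    and g0: "weak_upper_gradient p \<mu> E (\<lambda>x. ereal (v x)) g0" "in_Lp_loc p \<mu> E g0"
  shows "is_minimal_wug p \<mu> E (\<lambda>x. ereal (v x)) (minimal_wug p \<mu> E (\<lambda>x. ereal (v x)))"
proof -
  define G where "G = {g. weak_upper_gradient p \<mu> E (\<lambda>x. ereal (v x)) g \<and> in_Lp_loc p \<mu> E g}"
  have Es: "E \<in> sets \<mu>" using E by (intro mms_sets[OF mms]) auto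
  have meas: "g \<in> borel_measurable (restrict_space \<mu> E)" if "g \<in> G" for g
    using that by (simp add: G_def in_Lp_loc_def)
  have "\<exists>g\<in>G. \<forall>h\<in>G. AE x in restrict_space \<mu> E. g x \<le> h x"
  proof (rule essential_infimum)
    show "sigma_finite_measure (restrict_space \<mu> E)"
      by (rule sigma_finite_measure_restrict_space[OF mms_sigma_finite[OF mms] Es])
    show "G \<noteq> {}" using g0 by (auto simp: G_def)
    show "g \<in> borel_measurable (restrict_space \<mu> E)" if "g \<in> G" for g by (rule meas[OF that])
    show "(\<lambda>x. INF n. s n x) \<in> G" if s: "\<And>n. s n \<in> G" for s :: "nat \<Rightarrow> 'a \<Rightarrow> ennreal"
    proof -
      have m: "(\<lambda>x. INF n. s n x) \<in> borel_measurable (restrict_space \<mu> E)"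
        using meas[OF s] by (intro borel_measurable_INF) auto
      have "weak_upper_gradient p \<mu> E (\<lambda>x. ereal (v x)) (\<lambda>x. INF n\<in>{n. x \<in> E}. s n x)"
      proof (rule weak_upper_gradient_INF_loc[OF mms p E])
        fix n
        show "weak_upper_gradient p \<mu> E (\<lambda>x. ereal (v x)) (s n)" using s by (simp add: G_def)
        show "in_Lp_loc p \<mu> E (\<lambda>x. s n x * indicator E x)"
        proof (rule in_Lp_loc_mono_AE)
          show "in_Lp_loc p \<mu> E (s n)" using s by (simp add: G_def)
          show "(\<lambda>x. s n x * indicator E x) \<in> borel_measurable (restrict_space \<mu> E)"
            using meas[OF s, of n]
            by (rule measurable_cong[THEN iffD2, rotated]) (simp add: space_restrict_space)
        qed (use p in auto)
      qed (use E in \<open>auto simp: arc_curve_def\<close>)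
      then have "weak_upper_gradient p \<mu> E (\<lambda>x. ereal (v x)) (\<lambda>x. INF n. s n x)"
        by (rule weak_upper_gradient_mono_AE[OF mms p borel_open[OF E] _ m]) auto
      moreover have "in_Lp_loc p \<mu> E (\<lambda>x. INF n. s n x)"
      proof (rule in_Lp_loc_mono_AE[OF _ _ m])
        show "in_Lp_loc p \<mu> E (s 0)" using s by (simp add: G_def)
      qed (use p in \<open>auto intro: INF_lower\<close>)
      ultimately show ?thesis by (simp add: G_def)
    qed
  qed
  then obtain g where g: "g \<in> G" "\<And>h. h \<in> G \<Longrightarrow> AE x in restrict_space \<mu> E. g x \<le> h x"
    by blast
  have "is_minimal_wug p \<mu> E (\<lambda>x. ereal (v x)) g"
    using g Es mms_space[OF mms] unfolding is_minimal_wug_def G_def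
    by (auto simp: AE_restrict_space_iff)
  then show ?thesis unfolding minimal_wug_def
    by (rule someI[of "is_minimal_wug p \<mu> E (\<lambda>x. ereal (v x))"])
qed

lemma N1p_gradientE:
  assumes "u \<in> N1p p \<mu> E"
  obtains g where "weak_upper_gradient p \<mu> E u g" "(\<integral>\<^sup>+x\<in>E. ennpowr (g x) p \<partial>\<mu>) < \<infinity>"
proof -
  have "(INF g \<in> {g. weak_upper_gradient p \<mu> E u g}. \<integral>\<^sup>+x\<in>E. ennpowr (g x) p \<partial>\<mu>) \<le> N1p_norm_pow p \<mu> E u"
    unfolding N1p_norm_pow_def by simp
  also have "\<dots> < \<infinity>" using assms by (simp add: N1p_def)
  finally show thesis using that by (auto simp: INF_less_iff)
qed

text \<open>The case \<open>- \<Omega> = {}\<close> is separate because \<^const>\<open>infdist\<close> to the empty set is \<open>0\<close>.\<close>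

definition dist_exhaustion :: "'a::metric_space set \<Rightarrow> 'a \<Rightarrow> nat \<Rightarrow> 'a set" where
  "dist_exhaustion \<Omega> x0 n = ball x0 (real n) \<inter> {x. - \<Omega> = {} \<or> 1 / real (Suc n) < infdist x (- \<Omega>)}"

lemma open_dist_exhaustion: "open (dist_exhaustion \<Omega> x0 n)"
  unfolding dist_exhaustion_def
  by (cases "- \<Omega> = {}") (auto intro!: open_Int open_Collect_less continuous_intros)

lemma dist_exhaustion_subset: "dist_exhaustion \<Omega> x0 n \<subseteq> \<Omega>"
proof
  fix x assume x: "x \<in> dist_exhaustion \<Omega> x0 n"
  show "x \<in> \<Omega>"
  proof (rule ccontr)
    assume "x \<notin> \<Omega>"
    then have "infdist x (- \<Omega>) = 0" "- \<Omega> \<noteq> {}" by auto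
    with x show False by (simp add: dist_exhaustion_def)
  qed
qed

lemma dist_exhaustion_mono:
  assumes "m \<le> n"
  shows "dist_exhaustion \<Omega> x0 m \<subseteq> dist_exhaustion \<Omega> x0 n"
proof -
  have "1 / real (Suc n) \<le> 1 / real (Suc m)" using assms by (simp add: frac_le)
  then show ?thesis using assms unfolding dist_exhaustion_def by auto
qed

lemma UN_dist_exhaustion:
  assumes "open \<Omega>"
  shows "(\<Union>n. dist_exhaustion \<Omega> x0 n) = \<Omega>"
proof
  show "\<Omega> \<subseteq> (\<Union>n. dist_exhaustion \<Omega> x0 n)"
  proof
    fix x assume x: "x \<in> \<Omega>"
    obtain k where k: "- \<Omega> = {} \<or> 1 / real (Suc k) < infdist x (- \<Omega>)"
    proof (cases "- \<Omega> = {}")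
      case False
      then have "0 < infdist x (- \<Omega>)"
        using x assms by (intro infdist_pos_not_in_closed) auto
      then show ?thesis using that nat_approx_posE by metis
    qed (use that in auto)
    obtain m where m: "dist x0 x < real m" using reals_Archimedean2 by blast
    have "x \<in> dist_exhaustion \<Omega> x0 (max k m)"
    proof -
      have "1 / real (Suc (max k m)) \<le> 1 / real (Suc k)" by (simp add: frac_le)
      with k m show ?thesis by (auto simp: dist_exhaustion_def)
    qed
    then show "x \<in> (\<Union>n. dist_exhaustion \<Omega> x0 n)" by blast
  qed
qed (use dist_exhaustion_subset in blast)

lemma dist_exhaustion_G_dist: "dist_exhaustion \<Omega> x0 n \<in> G_dist \<Omega>"
proof -
  have "0 < setdist (dist_exhaustion \<Omega> x0 n) (- \<Omega>)" if ne: "dist_exhaustion \<Omega> x0 n \<noteq> {}" "- \<Omega> \<noteq> {}"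
  proof -
    have "1 / real (Suc n) \<le> setdist (dist_exhaustion \<Omega> x0 n) (- \<Omega>)"
    proof (rule le_setdistI[OF ne])
      fix x y assume "x \<in> dist_exhaustion \<Omega> x0 n" "y \<in> - \<Omega>"
      then show "1 / real (Suc n) \<le> dist x y"
        using infdist_le[of y "- \<Omega>" x] ne by (simp add: dist_exhaustion_def)
    qed
    moreover have "0 < 1 / real (Suc n)" by simp
    ultimately show ?thesis by linarith
  qed
  moreover have "bounded (dist_exhaustion \<Omega> x0 n)"
    by (rule bounded_subset[OF bounded_ball[of x0 "real n"]]) (auto simp: dist_exhaustion_def)
  ultimately show ?thesis
    using open_dist_exhaustion dist_exhaustion_subset by (fastforce simp: G_dist_def)
qed

text \<open>
  Each set of the exhaustion carries a gradient in \<open>L\<^sup>p\<close>.  Taking at each point the smallest of those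
  available there glues them: every curve is compact and so lies in one set of the exhaustion.
\<close>

lemma N1p_loc_dist_gradientE:
  fixes \<Omega> :: "'a::metric_space set"
  assumes mms: "metric_measure_space \<mu>" and p: "0 < p" and \<Omega>: "open \<Omega>"
    and u: "(\<lambda>x. ereal (u x)) \<in> N1p_loc_dist p \<mu> \<Omega>"
  obtains g where "weak_upper_gradient p \<mu> \<Omega> (\<lambda>x. ereal (u x)) g" "in_Lp_loc p \<mu> \<Omega> g"
proof -
  fix x0 :: 'a
  define H where "H = dist_exhaustion \<Omega> x0"
  have H: "\<And>n. open (H n)" "\<And>n. H n \<subseteq> \<Omega>" "(\<Union>n. H n) = \<Omega>" "\<And>m n. m \<le> n \<Longrightarrow> H m \<subseteq> H n"
    unfolding H_def
    by (rule open_dist_exhaustion dist_exhaustion_subset UN_dist_exhaustion[OF \<Omega>] dist_exhaustion_mono; assumption?)+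
  have Hb: "H n \<in> sets borel" for n using H(1) by auto
  have "\<exists>g. weak_upper_gradient p \<mu> (H n) (\<lambda>x. ereal (u x)) g \<and> (\<integral>\<^sup>+x\<in>H n. ennpowr (g x) p \<partial>\<mu>) < \<infinity>" for n
  proof -
    have "(\<lambda>x. ereal (u x)) \<in> N1p p \<mu> (H n)"
      using u dist_exhaustion_G_dist unfolding N1p_loc_dist_def H_def by blast
    then show ?thesis by (rule N1p_gradientE) blast
  qed
  then obtain g where g: "\<And>n. weak_upper_gradient p \<mu> (H n) (\<lambda>x. ereal (u x)) (g n)"
    and g_fin: "\<And>n. (\<integral>\<^sup>+x\<in>H n. ennpowr (g n x) p \<partial>\<mu>) < \<infinity>" by metis
  define G where "G x = (INF n\<in>{n. x \<in> H n}. g n x)" for x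
  have G: "weak_upper_gradient p \<mu> \<Omega> (\<lambda>x. ereal (u x)) G"
    unfolding G_def
  proof (rule weak_upper_gradient_INF_loc[OF mms p \<Omega> H(1,2) g])
    fix n
    have "(\<lambda>x. g n x * indicator (H n) x) \<in> borel_measurable \<mu>"
      using g[of n] Hb mms_sets[OF mms] mms_space[OF mms] unfolding weak_upper_gradient_def
      by (subst (asm) borel_measurable_restrict_space_iff_ennreal) auto
    then have "(\<lambda>x. g n x * indicator (H n) x) \<in> borel_measurable (restrict_space \<mu> \<Omega>)"
      by (rule measurable_restrict_space1)
    moreover have "(\<integral>\<^sup>+y\<in>\<Omega> \<inter> ball x 1. ennpowr (g n y * indicator (H n) y) p \<partial>\<mu>) < \<infinity>" for x
    proof -
      have "(\<integral>\<^sup>+y\<in>\<Omega> \<inter> ball x 1. ennpowr (g n y * indicator (H n) y) p \<partial>\<mu>)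
          \<le> (\<integral>\<^sup>+y\<in>H n. ennpowr (g n y) p \<partial>\<mu>)"
        by (intro nn_integral_mono) (auto split: split_indicator)
      then show ?thesis using g_fin by (rule order.strict_trans1)
    qed
    ultimately show "in_Lp_loc p \<mu> \<Omega> (\<lambda>x. g n x * indicator (H n) x)"
      unfolding in_Lp_loc_def by (auto intro!: exI[of _ "1::real"])
  next
    fix \<gamma> :: "real \<Rightarrow> 'a" and l assume \<gamma>: "arc_curve \<Omega> \<gamma> l"
    then have "compact (\<gamma> ` {0..l})" and sub: "\<gamma> ` {0..l} \<subseteq> \<Omega>"
      by (auto simp: arc_curve_def intro!: compact_continuous_image)
    then obtain C where C: "C \<subseteq> range H" "finite C" "\<gamma> ` {0..l} \<subseteq> \<Union>C"
      using H(1,3) by (elim compactE[of _ "range H"]) auto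
    obtain N where N: "finite N" "C = H ` N" using finite_subset_image[OF C(2,1)] by blast
    have "H n \<subseteq> H (Max (insert 0 N))" if "n \<in> N" for n
      using N(1) that by (intro H(4) Max_ge) auto
    then have "\<Union>C \<subseteq> H (Max (insert 0 N))" using N(2) by blast
    with C(3) show "\<exists>n. \<gamma> ` {0..l} \<subseteq> H n" by blast
  qed
  moreover have "in_Lp_loc p \<mu> \<Omega> G"
    unfolding in_Lp_loc_def
  proof (intro conjI ballI)
    show "G \<in> borel_measurable (restrict_space \<mu> \<Omega>)" using G by (simp add: weak_upper_gradient_def)
    fix x assume "x \<in> \<Omega>"
    then obtain n where n: "x \<in> H n" using H(3) by blast
    then obtain r where r: "0 < r" "ball x r \<subseteq> H n" using H(1) open_contains_ball by blast
    have "(\<integral>\<^sup>+y\<in>\<Omega> \<inter> ball x r. ennpowr (G y) p \<partial>\<mu>) \<le> (\<integral>\<^sup>+y\<in>H n. ennpowr (g n y) p \<partial>\<mu>)"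
      using r(2) p unfolding G_def
      by (intro nn_integral_mono) (auto intro!: ennpowr_mono INF_lower split: split_indicator)
    then have "(\<integral>\<^sup>+y\<in>\<Omega> \<inter> ball x r. ennpowr (G y) p \<partial>\<mu>) < \<infinity>"
      using g_fin by (rule order.strict_trans1)
    with r(1) show "\<exists>r>0. (\<integral>\<^sup>+y\<in>\<Omega> \<inter> ball x r. ennpowr (G y) p \<partial>\<mu>) < \<infinity>" by blast
  qed
  ultimately show thesis by (rule that)
qed

section \<open>Zero extension, truncation and locality\<close>

lemma first_hitting_point:
  fixes \<psi> :: "real \<Rightarrow> real"
  assumes cont: "continuous_on {s..t} \<psi>" and st: "s \<le> t" and e: "e \<le> \<psi> s" "\<psi> t \<le> e"
  obtains r where "s \<le> r" "r \<le> t" "\<psi> r = e" "\<forall>x\<in>{s..r}. e \<le> \<psi> x"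
proof -
  define Z where "Z = {x \<in> {s..t}. \<psi> x = e}"
  have "compact Z"
  proof -
    have "closed Z" unfolding Z_def by (rule continuous_closed_preimage_constant[OF cont]) simp
    moreover have "bounded Z" by (rule bounded_subset[of "{s..t}"]) (auto simp: Z_def)
    ultimately show ?thesis by (simp add: compact_eq_bounded_closed)
  qed
  moreover have "Z \<noteq> {}" using IVT2'[OF e(2,1) st cont] by (auto simp: Z_def)
  ultimately obtain r where r: "r \<in> Z" "\<And>x. x \<in> Z \<Longrightarrow> r \<le> x"
    using compact_attains_inf[of Z] by blast
  show thesis
  proof
    show "s \<le> r" "r \<le> t" "\<psi> r = e" using r(1) by (auto simp: Z_def)
    show "\<forall>x\<in>{s..r}. e \<le> \<psi> x"
    proof (rule ballI, rule ccontr)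
      fix x assume x: "x \<in> {s..r}"
      assume neg: "\<not> e \<le> \<psi> x"
      have "continuous_on {s..x} \<psi>"
        using x r(1) by (intro continuous_on_subset[OF cont]) (auto simp: Z_def)
      then obtain y where y: "s \<le> y" "y \<le> x" "\<psi> y = e"
        using IVT2'[of \<psi> x e s] neg e(1) x by auto
      then have "y \<in> Z" using x r(1) by (auto simp: Z_def)
      then have "r \<le> y" by (rule r(2))
      with y x have "y = x" by auto
      with y neg show False by simp
    qed
  qed
qed

lemma last_hitting_point:
  fixes \<psi> :: "real \<Rightarrow> real"
  assumes cont: "continuous_on {t..s} \<psi>" and st: "t \<le> s" and e: "e \<le> \<psi> s" "\<psi> t \<le> e"
  obtains r where "t \<le> r" "r \<le> s" "\<psi> r = e" "\<forall>x\<in>{r..s}. e \<le> \<psi> x"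
proof -
  have "continuous_on {- s..- t} (\<lambda>x. \<psi> (- x))"
    by (rule continuous_on_compose2[OF cont]) (auto intro!: continuous_intros)
  from first_hitting_point[OF this, of e] st e
  obtain r where r: "- s \<le> r" "r \<le> - t" "\<psi> (- r) = e" "\<forall>x\<in>{- s..r}. e \<le> \<psi> (- x)"
    by auto
  show thesis
  proof
    show "\<forall>x\<in>{- r..s}. e \<le> \<psi> x"
    proof
      fix x assume "x \<in> {- r..s}"
      then show "e \<le> \<psi> x" using r(4)[rule_format, of "- x"] by auto
    qed
  qed (use r in auto)
qed

text \<open>
  Let a curve start in \<open>A\<close> and leave \<open>A\<close>.  Up to the first time at which \<open>\<bar>\<phi>\<bar>\<close> has dropped to a small
  \<open>e > 0\<close> the curve stays in \<open>A\<close>, because \<open>\<phi>\<close> vanishes outside; so \<open>\<bar>\<phi>\<bar>\<close> at the start is at most the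
  integral over \<open>A\<close> plus \<open>e\<close>.  If both end points are in \<open>A\<close> but the curve leaves \<open>A\<close>, this bounds both
  values, and as they have the same sign their difference is at most the larger of the two
  in absolute value.
\<close>

lemma weak_upper_gradient_zero_extension:
  fixes \<phi> :: "'a::metric_space \<Rightarrow> real"
  assumes mms: "metric_measure_space \<mu>" and p: "0 < p" and A: "open A"
    and cont: "continuous_on UNIV \<phi>" and nonpos: "\<And>x. \<phi> x \<le> 0" and zero: "\<And>x. x \<notin> A \<Longrightarrow> \<phi> x = 0"
    and f: "weak_upper_gradient p \<mu> A (\<lambda>x. ereal (\<phi> x)) f"
  shows "weak_upper_gradient p \<mu> UNIV (\<lambda>x. ereal (\<phi> x)) (\<lambda>x. f x * indicator A x)"
proof -
  have Ab[measurable]: "A \<in> sets borel" using A by auto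
  obtain h where h[measurable]: "h \<in> borel_measurable borel" and fh: "AE x in \<mu>. x \<in> A \<longrightarrow> f x = h x"
    using mms_borel_version[OF mms Ab, of f] f unfolding weak_upper_gradient_def by blast
  have hb: "g \<in> borel_measurable (restrict_space \<mu> B)" if "g \<in> borel_measurable borel" for g :: "'a \<Rightarrow> ennreal" and B
    by (intro measurable_restrict_space1 mms_measurable[OF mms] that)
  have "weak_upper_gradient p \<mu> A (\<lambda>x. ereal (\<phi> x)) h"
    by (rule weak_upper_gradient_mono_AE[OF mms p Ab f hb[OF h]])
       (use fh in \<open>auto elim: eventually_mono\<close>)
  note sub = weak_upper_gradient_on_subcurves[OF this h Ab, of UNIV]
  have hA: "(\<lambda>x. h x * indicator A x) \<in> borel_measurable borel" by measurable
  have "weak_upper_gradient p \<mu> UNIV (\<lambda>x. ereal (\<phi> x)) (\<lambda>x. h x * indicator A x)"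
    unfolding weak_upper_gradient_def
  proof (intro conjI hb[OF hA] ae_curve_mono[OF sub])
    fix \<gamma> :: "real \<Rightarrow> 'a" and l
    assume \<gamma>: "arc_curve UNIV \<gamma> l"
      and bound: "\<forall>s t. 0 \<le> s \<and> s \<le> t \<and> t \<le> l \<and> \<gamma> ` {s..t} \<subseteq> A \<longrightarrow>
        ennreal \<bar>\<phi> (\<gamma> s) - \<phi> (\<gamma> t)\<bar> \<le> (\<integral>\<^sup>+\<tau>\<in>{s..t}. h (\<gamma> \<tau>) \<partial>lborel)"
    have l: "0 < l" and \<gamma>_cont: "continuous_on {0..l} \<gamma>" using \<gamma> by (auto simp: arc_curve_def)
    define \<psi> where "\<psi> t = - \<phi> (\<gamma> t)" for t
    have \<psi>_cont: "continuous_on {0..l} \<psi>"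
      unfolding \<psi>_def by (intro continuous_intros continuous_on_compose2[OF cont \<gamma>_cont]) auto
    define I where "I = curve_integral \<gamma> l (\<lambda>x. h x * indicator A x)"
    have int_le: "ennreal \<bar>\<psi> s - \<psi> t\<bar> \<le> I" if st: "0 \<le> s" "s \<le> t" "t \<le> l" "\<gamma> ` {s..t} \<subseteq> A" for s t
    proof -
      have "ennreal \<bar>\<psi> s - \<psi> t\<bar> = ennreal \<bar>\<phi> (\<gamma> s) - \<phi> (\<gamma> t)\<bar>"
        by (simp add: \<psi>_def abs_minus_commute)
      also have "\<dots> \<le> (\<integral>\<^sup>+\<tau>\<in>{s..t}. h (\<gamma> \<tau>) \<partial>lborel)" using bound st by blast
      also have "\<dots> \<le> I"
        unfolding I_def curve_integral_lborel
        using st by (intro nn_integral_mono) (auto simp: image_subset_iff split: split_indicator)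
      finally show ?thesis .
    qed
    have leave: "ennreal (\<psi> s) \<le> I" if s: "s \<in> {0..l}" and t: "t \<in> {0..l}" "\<gamma> t \<notin> A" for s t
    proof (rule ennreal_le_epsilon)
      fix e :: real assume e: "0 < e"
      have t0: "\<psi> t \<le> e" using zero[OF t(2)] e by (simp add: \<psi>_def)
      show "ennreal (\<psi> s) \<le> I + ennreal e"
      proof (cases "e \<le> \<psi> s")
        case False
        then have "ennreal (\<psi> s) \<le> ennreal e" by (intro ennreal_leI) simp
        then show ?thesis by (rule order_trans) simp
      next
        case True
        have inA: "\<gamma> x \<in> A" if "e \<le> \<psi> x" for x
          using that e zero[of "\<gamma> x"] by (auto simp: \<psi>_def)
        obtain r where r: "\<psi> r = e" "ennreal \<bar>\<psi> s - \<psi> r\<bar> \<le> I"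
        proof (cases "s \<le> t")
          case st: True
          have "continuous_on {s..t} \<psi>"
            by (rule continuous_on_subset[OF \<psi>_cont]) (use s t in auto)
          then obtain r where r: "s \<le> r" "r \<le> t" "\<psi> r = e" "\<forall>x\<in>{s..r}. e \<le> \<psi> x"
            by (rule first_hitting_point[OF _ st True t0])
          then have "ennreal \<bar>\<psi> s - \<psi> r\<bar> \<le> I"
            using s t inA by (intro int_le) auto
          with r(3) show ?thesis by (rule that)
        next
          case st: False
          have "continuous_on {t..s} \<psi>"
            by (rule continuous_on_subset[OF \<psi>_cont]) (use s t in auto)
          then obtain r where r: "t \<le> r" "r \<le> s" "\<psi> r = e" "\<forall>x\<in>{r..s}. e \<le> \<psi> x"
            by (rule last_hitting_point[of t s \<psi> e]) (use st True t0 in auto)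
          then have "ennreal \<bar>\<psi> r - \<psi> s\<bar> \<le> I"
            using s t inA by (intro int_le) auto
          with r(3) show ?thesis by (intro that[of r]) (simp_all add: abs_minus_commute)
        qed
        have "ennreal (\<psi> s) = ennreal (\<bar>\<psi> s - \<psi> r\<bar> + e)" using r(1) True by simp
        also have "\<dots> = ennreal \<bar>\<psi> s - \<psi> r\<bar> + ennreal e" using e by simp
        also have "\<dots> \<le> I + ennreal e" using r(2) by (rule add_right_mono)
        finally show ?thesis .
      qed
    qed
    have "ennreal \<bar>\<psi> 0 - \<psi> l\<bar> \<le> I"
    proof (cases "\<gamma> ` {0..l} \<subseteq> A")
      case True
      then show ?thesis using int_le[of 0 l] l by simp
    next
      case False
      then obtain t where t: "t \<in> {0..l}" "\<gamma> t \<notin> A" by blast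
      have "\<bar>\<psi> 0 - \<psi> l\<bar> \<le> max (\<psi> 0) (\<psi> l)"
        using nonpos[of "\<gamma> 0"] nonpos[of "\<gamma> l"] by (auto simp: \<psi>_def)
      then have "ennreal \<bar>\<psi> 0 - \<psi> l\<bar> \<le> ennreal (max (\<psi> 0) (\<psi> l))" by (rule ennreal_leI)
      also have "\<dots> \<le> I"
        using leave[OF _ t, of 0] leave[OF _ t, of l] l by (auto simp: max_def)
      finally show ?thesis .
    qed
    then show "ediff (ereal (\<phi> (\<gamma> 0))) (ereal (\<phi> (\<gamma> l))) \<le> curve_integral \<gamma> l (\<lambda>x. h x * indicator A x)"
      by (simp add: ediff_ereal \<psi>_def I_def abs_minus_commute)
  qed
  then show ?thesis
  proof (rule weak_upper_gradient_mono_AE[OF mms p, rotated])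
    have "(\<lambda>x. f x * indicator A x) \<in> borel_measurable \<mu>"
      using f Ab mms_sets[OF mms] mms_space[OF mms] unfolding weak_upper_gradient_def
      by (subst (asm) borel_measurable_restrict_space_iff_ennreal) auto
    then show "(\<lambda>x. f x * indicator A x) \<in> borel_measurable (restrict_space \<mu> UNIV)"
      by (rule measurable_restrict_space1)
    show "AE x in \<mu>. x \<in> UNIV \<longrightarrow> h x * indicator A x \<le> f x * indicator A x"
      using fh by eventually_elim (auto split: split_indicator)
  qed simp
qed

text \<open>
  A curve with one end point in \<open>A\<close> meets the frontier of \<open>A\<close>, where \<open>u\<close> already has the value \<open>k\<close>.
\<close>

lemma weak_upper_gradient_truncate:
  fixes u :: "'a::metric_space \<Rightarrow> real"
  assumes mms: "metric_measure_space \<mu>" and p: "0 < p" and \<Omega>: "\<Omega> \<in> sets borel"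
    and k: "\<And>x. x \<in> frontier A \<Longrightarrow> x \<in> \<Omega> \<Longrightarrow> u x = k"
    and g: "weak_upper_gradient p \<mu> \<Omega> (\<lambda>x. ereal (u x)) g"
  shows "weak_upper_gradient p \<mu> \<Omega> (\<lambda>x. ereal (if x \<in> A then k else u x)) g"
proof -
  define v where "v x = (if x \<in> A then k else u x)" for x
  obtain h where h[measurable]: "h \<in> borel_measurable borel" and gh: "AE x in \<mu>. x \<in> \<Omega> \<longrightarrow> g x = h x"
    using mms_borel_version[OF mms \<Omega>, of g] g unfolding weak_upper_gradient_def by blast
  have hb: "h \<in> borel_measurable (restrict_space \<mu> \<Omega>)"
    by (intro measurable_restrict_space1 mms_measurable[OF mms] h)
  have "weak_upper_gradient p \<mu> \<Omega> (\<lambda>x. ereal (u x)) h"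
    by (rule weak_upper_gradient_mono_AE[OF mms p \<Omega> g hb])
       (use gh in \<open>auto elim: eventually_mono\<close>)
  note sub = weak_upper_gradient_on_subcurves[OF this h \<Omega>, of \<Omega>]
  have "weak_upper_gradient p \<mu> \<Omega> (\<lambda>x. ereal (v x)) h"
    unfolding weak_upper_gradient_def
  proof (intro conjI hb ae_curve_mono[OF sub])
    fix \<gamma> :: "real \<Rightarrow> 'a" and l
    assume \<gamma>: "arc_curve \<Omega> \<gamma> l"
      and bound: "\<forall>s t. 0 \<le> s \<and> s \<le> t \<and> t \<le> l \<and> \<gamma> ` {s..t} \<subseteq> \<Omega> \<longrightarrow>
        ennreal \<bar>u (\<gamma> s) - u (\<gamma> t)\<bar> \<le> (\<integral>\<^sup>+\<tau>\<in>{s..t}. h (\<gamma> \<tau>) \<partial>lborel)"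
    have l: "0 < l" and \<gamma>_cont: "continuous_on {0..l} \<gamma>" and \<gamma>\<Omega>: "\<gamma> ` {0..l} \<subseteq> \<Omega>"
      using \<gamma> by (auto simp: arc_curve_def)
    have int_le: "ennreal \<bar>u (\<gamma> s) - u (\<gamma> t)\<bar> \<le> curve_integral \<gamma> l h" if st: "0 \<le> s" "s \<le> t" "t \<le> l" for s t
    proof -
      have "\<gamma> ` {s..t} \<subseteq> \<Omega>" using st \<gamma>\<Omega> by (auto simp: image_subset_iff)
      then have "ennreal \<bar>u (\<gamma> s) - u (\<gamma> t)\<bar> \<le> (\<integral>\<^sup>+\<tau>\<in>{s..t}. h (\<gamma> \<tau>) \<partial>lborel)" using bound st by blast
      also have "\<dots> \<le> curve_integral \<gamma> l h"
        unfolding curve_integral_lborel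
        using st by (intro nn_integral_mono) (auto split: split_indicator)
      finally show ?thesis .
    qed
    have cross: "\<exists>r\<in>{0..l}. u (\<gamma> r) = k" if "s \<in> {0..l}" "\<gamma> s \<in> A" "t \<in> {0..l}" "\<gamma> t \<notin> A" for s t
    proof -
      have "connected (\<gamma> ` {0..l})" by (rule connected_continuous_image[OF \<gamma>_cont connected_Icc])
      from connected_Int_frontier[OF this, of A] that
      obtain r where "r \<in> {0..l}" "\<gamma> r \<in> frontier A" by blast
      moreover from this have "\<gamma> r \<in> \<Omega>" using \<gamma>\<Omega> by blast
      ultimately show ?thesis using k by blast
    qed
    have "ennreal \<bar>v (\<gamma> 0) - v (\<gamma> l)\<bar> \<le> curve_integral \<gamma> l h"
    proof (cases "\<gamma> 0 \<in> A"; cases "\<gamma> l \<in> A")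
      assume "\<gamma> 0 \<in> A" "\<gamma> l \<notin> A"
      moreover from this obtain r where "r \<in> {0..l}" "u (\<gamma> r) = k" using cross[of 0 l] l by auto
      ultimately show ?thesis using int_le[of r l] by (simp add: v_def)
    next
      assume "\<gamma> 0 \<notin> A" "\<gamma> l \<in> A"
      moreover from this obtain r where "r \<in> {0..l}" "u (\<gamma> r) = k" using cross[of l 0] l by auto
      ultimately show ?thesis using int_le[of 0 r] by (simp add: v_def)
    qed (use int_le[of 0 l] l in \<open>auto simp: v_def\<close>)
    then show "ediff (ereal (v (\<gamma> 0))) (ereal (v (\<gamma> l))) \<le> curve_integral \<gamma> l h"
      by (simp add: ediff_ereal)
  qed
  then have "weak_upper_gradient p \<mu> \<Omega> (\<lambda>x. ereal (v x)) g"
    by (rule weak_upper_gradient_mono_AE[OF mms p \<Omega>])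
       (use g gh in \<open>auto simp: weak_upper_gradient_def elim: eventually_mono\<close>)
  then show ?thesis by (simp add: v_def)
qed

text \<open>
  On \<open>A\<close> the zero function is a gradient.  Gluing it with \<open>g\<close> gives a competitor that vanishes on \<open>A\<close>,
  and \<open>g\<close> is minimal.
\<close>

lemma is_minimal_wug_zero_where_constant:
  fixes v :: "'a::metric_space \<Rightarrow> real"
  assumes mms: "metric_measure_space \<mu>" and p: "0 < p" and \<Omega>: "open \<Omega>" and A: "open A" "A \<subseteq> \<Omega>"
    and const: "\<And>x. x \<in> A \<Longrightarrow> v x = k"
    and min: "is_minimal_wug p \<mu> \<Omega> (\<lambda>x. ereal (v x)) g"
  shows "AE x in \<mu>. x \<in> A \<longrightarrow> g x = 0"
proof -
  define U where "U n = (if n = 0 then \<Omega> else A)" for n :: nat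
  define f where "f n x = (if n = 0 then g x else 0)" for n :: nat and x
  have g: "weak_upper_gradient p \<mu> \<Omega> (\<lambda>x. ereal (v x)) g" "in_Lp_loc p \<mu> \<Omega> g"
    using min by (auto simp: is_minimal_wug_def)
  have gm: "g \<in> borel_measurable (restrict_space \<mu> \<Omega>)" using g(2) by (simp add: in_Lp_loc_def)
  have INF_zero: "(INF n\<in>{n. x \<in> U n}. f n x) = 0" if "x \<in> A" for x
  proof -
    have "(INF n\<in>{n. x \<in> U n}. f n x) \<le> f 1 x" by (rule INF_lower) (simp add: U_def that)
    then show ?thesis by (simp add: f_def)
  qed
  have INF_le: "(INF n\<in>{n. x \<in> U n}. f n x) \<le> g x" if "x \<in> \<Omega>" for x
  proof -
    have "(INF n\<in>{n. x \<in> U n}. f n x) \<le> f 0 x" by (rule INF_lower) (simp add: U_def that)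
    then show ?thesis by (simp add: f_def)
  qed
  have wug: "weak_upper_gradient p \<mu> \<Omega> (\<lambda>x. ereal (v x)) (\<lambda>x. INF n\<in>{n. x \<in> U n}. f n x)"
  proof (rule weak_upper_gradient_INF_loc[OF mms p \<Omega>])
    fix n :: nat
    show "open (U n)" "U n \<subseteq> \<Omega>" using A \<Omega> by (auto simp: U_def)
    show "weak_upper_gradient p \<mu> (U n) (\<lambda>x. ereal (v x)) (f n)"
    proof (cases "n = 0")
      case True
      then have "U n = \<Omega>" "f n = g" by (auto simp: U_def f_def)
      then show ?thesis using g(1) by simp
    next
      case False
      then have eq: "U n = A" "f n = (\<lambda>_. 0)" by (auto simp: U_def f_def)
      have "ae_curve p \<mu> A (\<lambda>\<gamma> l. ediff (ereal (v (\<gamma> 0))) (ereal (v (\<gamma> l))) \<le> curve_integral \<gamma> l (\<lambda>_. 0))"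
      proof (rule ae_curveI[of "\<lambda>_. 0"])
        fix \<gamma> l assume "arc_curve A \<gamma> l"
        then have "\<gamma> 0 \<in> A" "\<gamma> l \<in> A" by (auto simp: arc_curve_def)
        then show "ediff (ereal (v (\<gamma> 0))) (ereal (v (\<gamma> l))) \<le> curve_integral \<gamma> l (\<lambda>_. 0)"
          using const by (simp add: ediff_ereal)
      qed auto
      then show ?thesis unfolding eq weak_upper_gradient_def by simp
    qed
    show "in_Lp_loc p \<mu> \<Omega> (\<lambda>x. f n x * indicator (U n) x)"
    proof (rule in_Lp_loc_mono_AE[OF g(2)])
      show "(\<lambda>x. f n x * indicator (U n) x) \<in> borel_measurable (restrict_space \<mu> \<Omega>)"
        by (rule measurable_cong[THEN iffD2, of _ _ "if n = 0 then g else (\<lambda>_. 0)"])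
          (use gm in \<open>auto simp: f_def U_def space_restrict_space\<close>)
    qed (use p in \<open>auto simp: f_def U_def split: split_indicator\<close>)
  next
    fix \<gamma> l assume "arc_curve \<Omega> \<gamma> l"
    then have "\<gamma> ` {0..l} \<subseteq> U 0" by (simp add: U_def arc_curve_def)
    then show "\<exists>n. \<gamma> ` {0..l} \<subseteq> U n" by blast
  qed
  have "in_Lp_loc p \<mu> \<Omega> (\<lambda>x. INF n\<in>{n. x \<in> U n}. f n x)"
    by (rule in_Lp_loc_mono_AE[OF g(2)]) (use p wug INF_le in \<open>auto simp: weak_upper_gradient_def\<close>)
  with wug min have "AE x in \<mu>. x \<in> \<Omega> \<longrightarrow> g x \<le> (INF n\<in>{n. x \<in> U n}. f n x)"
    unfolding is_minimal_wug_def by blast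
  then show ?thesis
    by eventually_elim (use INF_zero A(2) in auto)
qed

section \<open>Functions with zero upper gradient\<close>

text \<open>
  By the Poincare inequality \<open>\<phi>\<close> equals its mean almost everywhere on every small ball, and then
  everywhere by continuity, because nonempty open sets have positive measure.  So \<open>\<phi>\<close> is locally
  constant on a connected space.
\<close>

lemma constant_if_zero_upper_gradient:
  fixes \<phi> :: "'a::metric_space \<Rightarrow> real"
  assumes mms: "metric_measure_space \<mu>" and p: "0 < p" and conn: "connected (UNIV :: 'a set)"
    and poincare: "local_Poincare p \<mu>" and cont: "continuous_on UNIV \<phi>"
    and zero: "weak_upper_gradient p \<mu> UNIV (\<lambda>x. ereal (\<phi> x)) (\<lambda>_. 0)"
  shows "\<phi> x = \<phi> y"
proof (rule connected_local_const[OF conn])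
  show "\<forall>x0\<in>UNIV. eventually (\<lambda>y. \<phi> x0 = \<phi> y) (at x0 within UNIV)"
  proof
    fix x0
    have \<phi>b[measurable]: "\<phi> \<in> borel_measurable borel"
      using cont by (rule borel_measurable_continuous_onI)
    have [measurable]: "\<phi> \<in> borel_measurable \<mu>" by (rule mms_measurable[OF mms \<phi>b])
    have ball_m[measurable]: "ball x r \<in> sets \<mu>" for x r by (rule mms_sets[OF mms]) auto
    have ball_pos: "0 < emeasure \<mu> (ball x r)" and ball_fin: "emeasure \<mu> (ball x r) < \<infinity>" if "0 < r" for x r
      using mms that unfolding metric_measure_space_def by blast+
    obtain r0 C \<Lambda> where r0: "r0 > 0" and L: "\<Lambda> \<ge> 1" and P: "\<forall>x r u g.
        0 < r \<and> ball x r \<subseteq> ball x0 r0 \<and>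
        u \<in> borel_measurable (restrict_space \<mu> (ball x (\<Lambda> * r))) \<and>
        (\<integral>\<^sup>+y\<in>ball x (\<Lambda> * r). e2ennreal \<bar>u y\<bar> \<partial>\<mu>) < \<infinity> \<and>
        weak_upper_gradient p \<mu> (ball x (\<Lambda> * r)) u g \<longrightarrow>
        (\<integral>\<^sup>+y\<in>ball x r. e2ennreal \<bar>u y - ereal (ball_mean \<mu> (ball x r) u)\<bar> \<partial>\<mu>)
            / emeasure \<mu> (ball x r)
        \<le> ennreal (C * r) *
            ennpowr ((\<integral>\<^sup>+y\<in>ball x (\<Lambda> * r). ennpowr (g y) p \<partial>\<mu>)
                       / emeasure \<mu> (ball x (\<Lambda> * r))) (1 / p)"
      using spec[OF poincare[unfolded local_Poincare_def], of x0] by (elim exE conjE) (rule that)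
    have "isCont \<phi> x0" using cont by (simp add: continuous_on_eq_continuous_at)
    then obtain d where d: "d > 0" "\<And>y. dist y x0 < d \<Longrightarrow> dist (\<phi> y) (\<phi> x0) < 1"
      unfolding continuous_at_eps_delta by (metis zero_less_one)
    \<comment> \<open>On the enlarged ball \<open>\<phi>\<close> has to be integrable; continuity at \<open>x0\<close> makes it bounded there.\<close>
    define r where "r = min r0 (d / \<Lambda>)"
    have r: "0 < r" "r \<le> r0" "\<Lambda> * r \<le> d" using r0 d L by (auto simp: r_def field_simps min_def)
    define m where "m = ball_mean \<mu> (ball x0 r) (\<lambda>x. ereal (\<phi> x))"
    have "0 < \<Lambda> * r" using r L by simp
    have "(\<integral>\<^sup>+y\<in>ball x0 (\<Lambda> * r). e2ennreal \<bar>ereal (\<phi> y)\<bar> \<partial>\<mu>)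
        \<le> (\<integral>\<^sup>+y. ennreal (\<bar>\<phi> x0\<bar> + 1) * indicator (ball x0 (\<Lambda> * r)) y \<partial>\<mu>)"
    proof (intro nn_integral_mono)
      fix y
      show "e2ennreal \<bar>ereal (\<phi> y)\<bar> * indicator (ball x0 (\<Lambda> * r)) y
        \<le> ennreal (\<bar>\<phi> x0\<bar> + 1) * indicator (ball x0 (\<Lambda> * r)) y"
      proof (cases "y \<in> ball x0 (\<Lambda> * r)")
        case True
        then have "dist y x0 < d" using r by (simp add: dist_commute)
        from d(2)[OF this] have "\<bar>\<phi> y\<bar> \<le> \<bar>\<phi> x0\<bar> + 1" by (simp add: dist_real_def)
        from ennreal_leI[OF this] show ?thesis
          using True by (simp add: e2ennreal_ereal del: ennreal_plus)
      qed simp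
    qed
    also have "\<dots> = ennreal (\<bar>\<phi> x0\<bar> + 1) * emeasure \<mu> (ball x0 (\<Lambda> * r))"
      by (rule nn_integral_cmult_indicator) simp
    also have "\<dots> < \<infinity>"
      using ball_fin[OF \<open>0 < \<Lambda> * r\<close>] by (simp add: ennreal_mult_less_top)
    finally have int_fin: "(\<integral>\<^sup>+y\<in>ball x0 (\<Lambda> * r). e2ennreal \<bar>ereal (\<phi> y)\<bar> \<partial>\<mu>) < \<infinity>" .
    have "(\<integral>\<^sup>+y\<in>ball x0 r. e2ennreal \<bar>ereal (\<phi> y) - ereal m\<bar> \<partial>\<mu>) / emeasure \<mu> (ball x0 r)
      \<le> ennreal (C * r) *
            ennpowr ((\<integral>\<^sup>+y\<in>ball x0 (\<Lambda> * r). ennpowr ((\<lambda>_. 0) y) p \<partial>\<mu>)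
                       / emeasure \<mu> (ball x0 (\<Lambda> * r))) (1 / p)"
      unfolding m_def
    proof (rule P[rule_format], intro conjI int_fin r(1))
      show "ball x0 r \<subseteq> ball x0 r0" using r by (rule_tac subset_ball)
      show "(\<lambda>x. ereal (\<phi> x)) \<in> borel_measurable (restrict_space \<mu> (ball x0 (\<Lambda> * r)))"
        by (rule measurable_restrict_space1) measurable
      show "weak_upper_gradient p \<mu> (ball x0 (\<Lambda> * r)) (\<lambda>x. ereal (\<phi> x)) (\<lambda>_. 0)"
        by (rule weak_upper_gradient_subset[OF mms zero]) auto
    qed
    then have "(\<integral>\<^sup>+y\<in>ball x0 r. e2ennreal \<bar>ereal (\<phi> y) - ereal m\<bar> \<partial>\<mu>) / emeasure \<mu> (ball x0 r) = 0"
      by simp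
    then have "(\<integral>\<^sup>+y\<in>ball x0 r. ennreal \<bar>\<phi> y - m\<bar> \<partial>\<mu>) = 0"
      using ball_fin[OF r(1), of x0] by (auto simp: ennreal_divide_eq_0_iff e2ennreal_ereal)
    then have ae: "AE y in \<mu>. y \<in> ball x0 r \<longrightarrow> \<phi> y = m"
      by (subst (asm) nn_integral_0_iff_AE) (auto elim!: eventually_mono split: split_indicator_asm)
    have eq_m: "\<phi> y = m" if y: "y \<in> ball x0 r" for y
    proof (rule ccontr)
      assume ne: "\<phi> y \<noteq> m"
      have "open {z. \<phi> z \<noteq> m}"
        by (intro open_Collect_neq cont continuous_on_const)
      then have "open ({z. \<phi> z \<noteq> m} \<inter> ball x0 r)" by auto
      then obtain s where s: "0 < s" "ball y s \<subseteq> {z. \<phi> z \<noteq> m} \<inter> ball x0 r"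
        using ne y openE[of "{z. \<phi> z \<noteq> m} \<inter> ball x0 r" y] by blast
      have "AE z in \<mu>. z \<notin> ball y s"
        using ae by eventually_elim (use s(2) in blast)
      then have "emeasure \<mu> (ball y s) = 0"
        by (subst (asm) AE_iff_measurable[OF ball_m]) (auto simp: mms_space[OF mms])
      then show False using ball_pos[OF s(1), of y] by simp
    qed
    then have "\<phi> x0 = \<phi> y" if "dist y x0 < r" for y
      using that r(1) by (simp add: dist_commute)
    then show "eventually (\<lambda>y. \<phi> x0 = \<phi> y) (at x0 within UNIV)"
      using r(1) by (auto simp: eventually_at)
  qed
qed auto

section \<open>The maximum principle\<close>

lemma e2ennreal_zero: "e2ennreal 0 = 0"
  using e2ennreal_ereal[of 0] by (simp add: zero_ereal_def)

lemma weak_upper_gradient_reflect: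
  assumes g: "weak_upper_gradient p \<mu> A (\<lambda>x. ereal (u x)) g"
    and eq: "\<And>x. x \<in> A \<Longrightarrow> \<phi> x = k - u x"
  shows "weak_upper_gradient p \<mu> A (\<lambda>x. ereal (\<phi> x)) g"
  unfolding weak_upper_gradient_def
proof
  have "ae_curve p \<mu> A (\<lambda>\<gamma> l. ediff (ereal (u (\<gamma> 0))) (ereal (u (\<gamma> l))) \<le> curve_integral \<gamma> l g)"
    using g by (simp add: weak_upper_gradient_def)
  then show "ae_curve p \<mu> A (\<lambda>\<gamma> l. ediff (ereal (\<phi> (\<gamma> 0))) (ereal (\<phi> (\<gamma> l))) \<le> curve_integral \<gamma> l g)"
  proof (rule ae_curve_mono)
    fix \<gamma> l assume "arc_curve A \<gamma> l"
      and le: "ediff (ereal (u (\<gamma> 0))) (ereal (u (\<gamma> l))) \<le> curve_integral \<gamma> l g"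
    then have "\<gamma> 0 \<in> A" "\<gamma> l \<in> A" by (auto simp: arc_curve_def)
    with le show "ediff (ereal (\<phi> (\<gamma> 0))) (ereal (\<phi> (\<gamma> l))) \<le> curve_integral \<gamma> l g"
      by (simp add: eq ediff_ereal abs_minus_commute)
  qed
qed (use g in \<open>simp add: weak_upper_gradient_def\<close>)

text \<open>
  This makes the test function of the maximum principle admissible, where \<open>A = {x \<in> G. k < u x}\<close> and
  \<open>\<phi>\<close> is the negative of the part of \<open>u\<close> above \<open>k\<close>.  Its size is controlled by \<open>u\<close> and by the constant
  \<open>k\<close> on a set of finite measure, and its gradient on \<open>A\<close> is that of \<open>u\<close>.
\<close>

lemma N1p_zero_negative_excess:
  fixes \<phi> u :: "'a::metric_space \<Rightarrow> real"
  assumes mms: "metric_measure_space \<mu>" and p: "0 < p"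
    and A: "open A" "A \<subseteq> G" and G: "open G" "bounded G"
    and u: "(\<lambda>x. ereal (u x)) \<in> N1p p \<mu> G"
    and cont: "continuous_on UNIV \<phi>" and nonpos: "\<And>x. \<phi> x \<le> 0"
    and zero: "\<And>x. x \<notin> A \<Longrightarrow> \<phi> x = 0" and eq: "\<And>x. x \<in> A \<Longrightarrow> \<phi> x = k - u x"
  shows "(\<lambda>x. ereal (\<phi> x)) \<in> N1p_zero p \<mu> G"
proof -
  have Gb[measurable]: "G \<in> sets borel" and Ab: "A \<in> sets borel" using G A by auto
  have G\<mu>[measurable]: "G \<in> sets \<mu>" by (rule mms_sets[OF mms Gb])
  have \<phi>b: "\<phi> \<in> borel_measurable borel" using cont by (rule borel_measurable_continuous_onI)
  have [measurable]: "\<phi> \<in> borel_measurable \<mu>" by (rule mms_measurable[OF mms \<phi>b])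
  obtain g where g: "weak_upper_gradient p \<mu> G (\<lambda>x. ereal (u x)) g"
    and g_fin: "(\<integral>\<^sup>+x\<in>G. ennpowr (g x) p \<partial>\<mu>) < \<infinity>"
    by (rule N1p_gradientE[OF u])
  have "weak_upper_gradient p \<mu> A (\<lambda>x. ereal (u x)) g"
    by (rule weak_upper_gradient_subset[OF mms g A(2) Gb Ab])
  then have "weak_upper_gradient p \<mu> A (\<lambda>x. ereal (\<phi> x)) g"
    using eq by (rule weak_upper_gradient_reflect)
  from weak_upper_gradient_zero_extension[OF mms p A(1) cont nonpos zero this]
  have wug: "weak_upper_gradient p \<mu> UNIV (\<lambda>x. ereal (\<phi> x)) (\<lambda>x. g x * indicator A x)" .
  have grad_fin: "(\<integral>\<^sup>+x\<in>UNIV. ennpowr (g x * indicator A x) p \<partial>\<mu>) < \<infinity>"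
  proof -
    have "(\<integral>\<^sup>+x\<in>UNIV. ennpowr (g x * indicator A x) p \<partial>\<mu>) \<le> (\<integral>\<^sup>+x\<in>G. ennpowr (g x) p \<partial>\<mu>)"
      using A(2) by (intro nn_integral_mono) (auto split: split_indicator)
    then show ?thesis using g_fin by (rule order.strict_trans1)
  qed
  have G_fin: "emeasure \<mu> G < \<infinity>"
  proof -
    obtain x0 r where r: "0 < r" "G \<subseteq> ball x0 r" using G(2) by (meson bounded_subset_ballD)
    have "emeasure \<mu> G \<le> emeasure \<mu> (ball x0 r)"
      using r(2) mms_sets[OF mms] by (intro emeasure_mono) auto
    also have "\<dots> < \<infinity>" using mms r(1) unfolding metric_measure_space_def by blast
    finally show ?thesis .
  qed
  have u_fin: "(\<integral>\<^sup>+x\<in>G. ennreal (\<bar>u x\<bar> powr p) \<partial>\<mu>) < \<infinity>"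
  proof -
    have "(\<integral>\<^sup>+x\<in>G. ennpowr (e2ennreal \<bar>ereal (u x)\<bar>) p \<partial>\<mu>) \<le> N1p_norm_pow p \<mu> G (\<lambda>x. ereal (u x))"
      unfolding N1p_norm_pow_def by simp
    also have "\<dots> < \<infinity>" using u by (simp add: N1p_def)
    finally show ?thesis by (simp add: e2ennreal_ereal ennpowr_ennreal)
  qed
  have u_meas: "(\<lambda>x. ennreal (\<bar>u x\<bar> powr p) * indicator G x) \<in> borel_measurable \<mu>"
  proof -
    have "(\<lambda>x. ereal (u x)) \<in> borel_measurable (restrict_space \<mu> G)" using u by (simp add: N1p_def)
    then have [measurable]: "u \<in> borel_measurable (restrict_space \<mu> G)"
      by (simp add: borel_measurable_ereal_iff)
    have "(\<lambda>x. ennreal (\<bar>u x\<bar> powr p)) \<in> borel_measurable (restrict_space \<mu> G)" by measurable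
    then show ?thesis
      by (subst (asm) borel_measurable_restrict_space_iff_ennreal) (auto simp: mms_space[OF mms])
  qed
  have fun_fin: "(\<integral>\<^sup>+x\<in>UNIV. ennpowr (e2ennreal \<bar>ereal (\<phi> x)\<bar>) p \<partial>\<mu>) < \<infinity>"
  proof -
    define c where "c = ennreal (2 powr p)"
    have "(\<integral>\<^sup>+x\<in>UNIV. ennpowr (e2ennreal \<bar>ereal (\<phi> x)\<bar>) p \<partial>\<mu>)
      \<le> (\<integral>\<^sup>+x. c * (ennreal (\<bar>u x\<bar> powr p) * indicator G x + ennreal (\<bar>k\<bar> powr p) * indicator G x) \<partial>\<mu>)"
    proof (rule nn_integral_mono)
      fix x
      show "ennpowr (e2ennreal \<bar>ereal (\<phi> x)\<bar>) p * indicator UNIV x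
        \<le> c * (ennreal (\<bar>u x\<bar> powr p) * indicator G x + ennreal (\<bar>k\<bar> powr p) * indicator G x)"
      proof (cases "x \<in> A")
        case True
        have "\<bar>\<phi> x\<bar> \<le> 2 * max \<bar>u x\<bar> \<bar>k\<bar>" using eq[OF True] by auto
        then have "\<bar>\<phi> x\<bar> powr p \<le> (2 * max \<bar>u x\<bar> \<bar>k\<bar>) powr p" using p by (intro powr_mono2) auto
        also have "\<dots> = 2 powr p * max \<bar>u x\<bar> \<bar>k\<bar> powr p" by (simp add: powr_mult)
        also have "\<dots> \<le> 2 powr p * (\<bar>u x\<bar> powr p + \<bar>k\<bar> powr p)"
          by (intro mult_left_mono) (auto simp: max_def)
        finally have "ennreal (\<bar>\<phi> x\<bar> powr p) \<le> c * (ennreal (\<bar>u x\<bar> powr p) + ennreal (\<bar>k\<bar> powr p))"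
          by (simp add: c_def ennreal_leI flip: ennreal_mult ennreal_plus)
        then show ?thesis using True A(2) by (auto simp: e2ennreal_ereal ennpowr_ennreal)
      next
        case False
        then show ?thesis using zero by (simp add: zero_ereal_def[symmetric] e2ennreal_zero)
      qed
    qed
    also have "\<dots> = c * ((\<integral>\<^sup>+x\<in>G. ennreal (\<bar>u x\<bar> powr p) \<partial>\<mu>) + ennreal (\<bar>k\<bar> powr p) * emeasure \<mu> G)"
      using u_meas by (simp add: nn_integral_cmult nn_integral_add nn_integral_cmult_indicator)
    also have "\<dots> < \<infinity>"
      using u_fin G_fin by (simp add: c_def ennreal_mult_less_top)
    finally show ?thesis .
  qed
  have "N1p_norm_pow p \<mu> UNIV (\<lambda>x. ereal (\<phi> x)) < \<infinity>"
  proof -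
    have "(INF g \<in> {g. weak_upper_gradient p \<mu> UNIV (\<lambda>x. ereal (\<phi> x)) g}. \<integral>\<^sup>+x\<in>UNIV. ennpowr (g x) p \<partial>\<mu>)
        \<le> (\<integral>\<^sup>+x\<in>UNIV. ennpowr (g x * indicator A x) p \<partial>\<mu>)"
      using wug by (intro INF_lower) auto
    also note grad_fin
    finally show ?thesis using fun_fin by (simp add: N1p_norm_pow_def)
  qed
  moreover have "(\<lambda>x. ereal (\<phi> x)) \<in> borel_measurable (restrict_space \<mu> UNIV)"
    by (rule measurable_restrict_space1) measurable
  ultimately show ?thesis
    using zero A(2) by (auto simp: N1p_zero_def N1p_def zero_ereal_def)
qed

text \<open>
  As \<open>\<phi>\<close> approximates itself, only the norm of the zero function has to be computed.
\<close>

lemma N1p_zero_imp_N1p_zero_dist: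
  assumes mms: "metric_measure_space \<mu>" and G: "G \<in> G_dist \<Omega>"
    and \<phi>: "(\<lambda>x. ereal (\<phi> x)) \<in> N1p_zero p \<mu> G"
  shows "(\<lambda>x. ereal (\<phi> x)) \<in> N1p_zero_dist p \<mu> \<Omega>"
proof -
  have wug: "weak_upper_gradient p \<mu> UNIV (\<lambda>_. 0) (\<lambda>_. 0)"
    unfolding weak_upper_gradient_def
    by (auto intro!: ae_curveI[of "\<lambda>_. 0"] simp: ediff_def e2ennreal_zero)
  have "(INF g \<in> {g. weak_upper_gradient p \<mu> UNIV (\<lambda>_. 0) g}. \<integral>\<^sup>+x\<in>UNIV. ennpowr (g x) p \<partial>\<mu>)
      \<le> (\<integral>\<^sup>+x\<in>UNIV. ennpowr ((\<lambda>_. 0) x) p \<partial>\<mu>)"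
    using wug by (intro INF_lower) auto
  then have "N1p_norm_pow p \<mu> UNIV (\<lambda>_. 0) = 0"
    by (simp add: N1p_norm_pow_def e2ennreal_zero)
  then have "ennpowr (N1p_norm_pow p \<mu> UNIV (\<lambda>x. ereal (\<phi> x) - ereal (\<phi> x))) (1 / p) = 0"
    by (simp add: zero_ereal_def)
  then have "ennpowr (N1p_norm_pow p \<mu> UNIV (\<lambda>x. ereal (\<phi> x) - ereal (\<phi> x))) (1 / p) < ennreal \<epsilon>"
    if "0 < \<epsilon>" for \<epsilon>
    using that by simp
  moreover have "(\<lambda>x. ereal (\<phi> x)) \<in> N1p p \<mu> UNIV" using \<phi> by (simp add: N1p_zero_def)
  ultimately show ?thesis
    unfolding N1p_zero_dist_def
    by (intro CollectI conjI allI impI bexI[OF _ G] bexI[OF _ \<phi>])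
qed

lemma closure_subset_of_G_dist:
  assumes "G \<in> G_dist \<Omega>"
  shows "closure G \<subseteq> \<Omega>"
proof
  fix x assume x: "x \<in> closure G"
  show "x \<in> \<Omega>"
  proof (rule ccontr)
    assume nx: "x \<notin> \<Omega>"
    have "G \<noteq> {}" using x by auto
    with nx have pos: "0 < setdist G (- \<Omega>)" using assms by (auto simp: G_dist_def)
    then obtain y where y: "y \<in> G" "dist y x < setdist G (- \<Omega>)"
      using x by (auto simp: closure_approachable)
    moreover have "setdist G (- \<Omega>) \<le> dist y x" using y(1) nx by (intro setdist_le_dist) auto
    ultimately show False by simp
  qed
qed

text \<open>
  Let \<open>A = {y \<in> G. k < u y}\<close>, with \<open>\<phi> = k - u\<close> on \<open>A\<close> and \<open>\<phi> = 0\<close> elsewhere.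
  The function \<open>u + \<phi>\<close> equals \<open>k\<close> on \<open>A\<close>, so its minimal gradient vanishes there, and the
  quasiminimizing property forces the gradient of \<open>u\<close> to vanish on \<open>A\<close> as well.  Then \<open>\<phi>\<close> has zero
  gradient on the whole space and is constant; since \<open>\<phi> = 0\<close> off \<open>G\<close> and \<open>G \<noteq> X\<close>, it vanishes, which
  contradicts \<open>k < u x\<close>.
\<close>

lemma quasiharmonic_le_boundary_sup:
  fixes u :: "'a::metric_space \<Rightarrow> real"
  assumes p: "0 < p" and mms: "metric_measure_space \<mu>" and conn: "connected (UNIV :: 'a set)"
    and poincare: "local_Poincare p \<mu>" and \<Omega>: "open \<Omega>" and u: "quasiharmonic p \<mu> \<Omega> u"
    and G: "G \<in> G_dist \<Omega>" and G_ne: "G \<noteq> UNIV"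
    and k: "\<And>y. y \<in> frontier G \<Longrightarrow> u y < k" and x: "x \<in> G"
  shows "u x \<le> k"
proof (rule ccontr)
  assume "\<not> u x \<le> k"
  then have ux: "k < u x" by simp
  have Go: "open G" and Gb: "bounded G" and G\<Omega>: "G \<subseteq> \<Omega>" using G by (auto simp: G_dist_def)
  have clG: "closure G \<subseteq> \<Omega>" by (rule closure_subset_of_G_dist[OF G])
  have u_cont: "continuous_on \<Omega> u" and u_quasi: "quasiminimizer p \<mu> \<Omega> (\<lambda>x. ereal (u x))"
    using u by (auto simp: quasiharmonic_def)
  have u_loc: "(\<lambda>x. ereal (u x)) \<in> N1p_loc_dist p \<mu> \<Omega>" using u_quasi by (simp add: quasiminimizer_def)
  define A where "A = {y \<in> G. k < u y}"
  have A: "open A" "A \<subseteq> G"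
  proof -
    have "continuous_on G u" by (rule continuous_on_subset[OF u_cont G\<Omega>])
    then have "open (G \<inter> u -` {k<..})" using Go by (intro continuous_open_preimage) auto
    moreover have "A = G \<inter> u -` {k<..}" by (auto simp: A_def)
    ultimately show "open A" by simp
  qed (auto simp: A_def)
  have A\<Omega>: "A \<subseteq> \<Omega>" using A(2) G\<Omega> by blast
  have clA: "closure A \<subseteq> \<Omega>" using closure_mono[OF A(2)] clG by blast
  have frA: "u y = k" if y: "y \<in> closure A" "y \<notin> A" for y
  proof -
    have "u ` closure A \<subseteq> {k..}"
      by (rule image_closure_subset[OF continuous_on_subset[OF u_cont clA]]) (auto simp: A_def)
    then have ge: "k \<le> u y" using y(1) by auto
    have "y \<in> closure G" using y(1) closure_mono[OF A(2)] by blast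
    moreover have "y \<notin> frontier G" using k[of y] ge by auto
    ultimately have "y \<in> G" using Go by (auto simp: frontier_def interior_open)
    with y(2) ge show ?thesis by (auto simp: A_def)
  qed
  define \<phi> where "\<phi> y = (if y \<in> A then k - u y else 0)" for y
  have \<phi>_cont: "continuous_on UNIV \<phi>"
  proof -
    have "continuous_on (closure A \<union> - A) (\<lambda>y. if y \<in> A then k - u y else 0)"
      using A(1) frA
      by (intro continuous_on_cases continuous_intros continuous_on_subset[OF u_cont clA]) auto
    moreover have "closure A \<union> - A = UNIV" using closure_subset by blast
    ultimately show ?thesis by (simp add: \<phi>_def[abs_def])
  qed
  have \<phi>_nonpos: "\<phi> y \<le> 0" for y by (auto simp: \<phi>_def A_def)
  have \<phi>_zero: "\<phi> y = 0" if "y \<notin> A" for y using that by (simp add: \<phi>_def)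
  have \<phi>_eq: "\<phi> y = k - u y" if "y \<in> A" for y using that by (simp add: \<phi>_def)
  have "(\<lambda>y. ereal (\<phi> y)) \<in> N1p_zero p \<mu> G"
    by (rule N1p_zero_negative_excess[OF mms p A Go Gb _ \<phi>_cont \<phi>_nonpos \<phi>_zero \<phi>_eq])
       (use u_loc G in \<open>auto simp: N1p_loc_dist_def\<close>)
  then have \<phi>_test: "(\<lambda>y. ereal (\<phi> y)) \<in> N1p_zero_dist p \<mu> \<Omega>"
    by (rule N1p_zero_imp_N1p_zero_dist[OF mms G])
  define v where "v y = (if y \<in> A then k else u y)" for y
  have uv: "(\<lambda>y. ereal (u y) + ereal (\<phi> y)) = (\<lambda>y. ereal (v y))"
    by (auto simp: \<phi>_def v_def fun_eq_iff)
  have supp: "{y \<in> \<Omega>. ereal (\<phi> y) \<noteq> 0} = A"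
    using A\<Omega> by (auto simp: \<phi>_def A_def zero_ereal_def)
  obtain g0 where g0: "weak_upper_gradient p \<mu> \<Omega> (\<lambda>y. ereal (u y)) g0" "in_Lp_loc p \<mu> \<Omega> g0"
    by (rule N1p_loc_dist_gradientE[OF mms p \<Omega> u_loc])
  define gu where "gu = minimal_wug p \<mu> \<Omega> (\<lambda>y. ereal (u y))"
  define gv where "gv = minimal_wug p \<mu> \<Omega> (\<lambda>y. ereal (v y))"
  have gu: "is_minimal_wug p \<mu> \<Omega> (\<lambda>y. ereal (u y)) gu"
    unfolding gu_def by (rule is_minimal_wug_minimal_wug[OF mms p \<Omega> g0])
  have "weak_upper_gradient p \<mu> \<Omega> (\<lambda>y. ereal (v y)) g0"
    unfolding v_def
    by (rule weak_upper_gradient_truncate[OF mms p _ _ g0(1)])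
       (use \<Omega> A(1) frA in \<open>auto simp: frontier_def interior_open\<close>)
  then have gv: "is_minimal_wug p \<mu> \<Omega> (\<lambda>y. ereal (v y)) gv"
    unfolding gv_def by (rule is_minimal_wug_minimal_wug[OF mms p \<Omega> _ g0(2)])
  have gv_zero: "AE y in \<mu>. y \<in> A \<longrightarrow> gv y = 0"
    by (rule is_minimal_wug_zero_where_constant[OF mms p \<Omega> A(1) A\<Omega> _ gv]) (simp add: v_def)
  have Ab: "A \<in> sets borel" using A(1) by auto
  have gu_wug: "weak_upper_gradient p \<mu> \<Omega> (\<lambda>y. ereal (u y)) gu"
    using gu by (simp add: is_minimal_wug_def)
  have gu_A: "weak_upper_gradient p \<mu> A (\<lambda>y. ereal (u y)) gu"
    by (rule weak_upper_gradient_subset[OF mms gu_wug A\<Omega> _ Ab]) (use \<Omega> in auto)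
  have gu_zero: "AE y in \<mu>. y \<in> A \<longrightarrow> gu y = 0"
  proof -
    obtain Q where Q: "\<forall>\<phi>\<in>N1p_zero_dist p \<mu> \<Omega>.
        (\<integral>\<^sup>+x\<in>{x \<in> \<Omega>. \<phi> x \<noteq> 0}. ennpowr (gu x) p \<partial>\<mu>) \<le> ennreal Q *
          (\<integral>\<^sup>+x\<in>{x \<in> \<Omega>. \<phi> x \<noteq> 0}. ennpowr (minimal_wug p \<mu> \<Omega> (\<lambda>y. ereal (u y) + \<phi> y) x) p \<partial>\<mu>)"
      using u_quasi unfolding quasiminimizer_def gu_def by blast
    from bspec[OF Q \<phi>_test]
    have "(\<integral>\<^sup>+y\<in>A. ennpowr (gu y) p \<partial>\<mu>) \<le> ennreal Q * (\<integral>\<^sup>+y\<in>A. ennpowr (gv y) p \<partial>\<mu>)"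
      unfolding supp uv gv_def .
    moreover have "(\<integral>\<^sup>+y\<in>A. ennpowr (gv y) p \<partial>\<mu>) = (\<integral>\<^sup>+y. 0 \<partial>\<mu>)"
      using gv_zero by (intro nn_integral_cong_AE) (auto elim!: eventually_mono split: split_indicator)
    ultimately have "(\<integral>\<^sup>+y. ennpowr (gu y * indicator A y) p \<partial>\<mu>) = 0"
      by (simp add: ennpowr_indicator)
    moreover have [measurable]: "(\<lambda>y. gu y * indicator A y) \<in> borel_measurable \<mu>"
      using gu_A mms_sets[OF mms Ab] mms_space[OF mms] unfolding weak_upper_gradient_def
      by (subst (asm) borel_measurable_restrict_space_iff_ennreal) auto
    ultimately have "AE y in \<mu>. ennpowr (gu y * indicator A y) p = 0"
      by (subst (asm) nn_integral_0_iff_AE) auto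
    then show ?thesis by eventually_elim auto
  qed
  have "weak_upper_gradient p \<mu> A (\<lambda>y. ereal (\<phi> y)) (\<lambda>_. 0)"
  proof -
    have "weak_upper_gradient p \<mu> A (\<lambda>y. ereal (u y)) (\<lambda>_. 0)"
      by (rule weak_upper_gradient_mono_AE[OF mms p Ab gu_A])
         (use gu_zero in \<open>auto elim: eventually_mono\<close>)
    then show ?thesis using \<phi>_eq by (rule weak_upper_gradient_reflect)
  qed
  from weak_upper_gradient_zero_extension[OF mms p A(1) \<phi>_cont \<phi>_nonpos \<phi>_zero this]
  have "weak_upper_gradient p \<mu> UNIV (\<lambda>y. ereal (\<phi> y)) (\<lambda>_. 0)" by simp
  note const = constant_if_zero_upper_gradient[OF mms p conn poincare \<phi>_cont this]
  obtain z where "z \<notin> G" using G_ne by blast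
  then have "\<phi> z = 0" using A(2) by (intro \<phi>_zero) blast
  moreover have "\<phi> x < 0" using ux x by (simp add: \<phi>_def A_def)
  ultimately show False using const[of x z] by simp
qed

theorem theorem3p5:
  fixes p :: real
    and \<mu> :: "'a::metric_space measure"
    and \<Omega> G :: "'a set"
    and u :: "'a \<Rightarrow> real"
  assumes "1 < p"
    and "metric_measure_space \<mu>"
    and "connected (UNIV :: 'a set)"
    and "locally_doubling \<mu>"
    and "local_Poincare p \<mu>"
    and "open \<Omega>"
    and "quasiharmonic p \<mu> \<Omega> u"
    and "G \<in> G_dist \<Omega>"
    and "G \<noteq> {}"
    and "G \<noteq> UNIV"
  shows "(SUP x\<in>G. ereal (u x)) = (SUP x\<in>frontier G. ereal (u x))"
proof (rule antisym)
  show "(SUP x\<in>G. ereal (u x)) \<le> (SUP x\<in>frontier G. ereal (u x))"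
  proof (rule SUP_least, rule ccontr)
    fix x assume x: "x \<in> G" and "\<not> ereal (u x) \<le> (SUP x\<in>frontier G. ereal (u x))"
    then obtain k where k: "(SUP x\<in>frontier G. ereal (u x)) < ereal k" "ereal k < ereal (u x)"
      using ereal_dense2[of "SUP x\<in>frontier G. ereal (u x)" "ereal (u x)"] by (auto simp: not_le)
    have "u y < k" if "y \<in> frontier G" for y
    proof -
      have "ereal (u y) \<le> (SUP x\<in>frontier G. ereal (u x))" using that by (rule SUP_upper)
      then have "ereal (u y) < ereal k" using k(1) by (rule order.strict_trans1)
      then show ?thesis by simp
    qed
    then have "u x \<le> k"
      using assms x by (intro quasiharmonic_le_boundary_sup[of p \<mu> \<Omega> u G k x]) auto
    then show False using k(2) by simp
  qed
  show "(SUP x\<in>frontier G. ereal (u x)) \<le> (SUP x\<in>G. ereal (u x))"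
  proof (rule SUP_least)
    fix x assume x: "x \<in> frontier G"
    have cl: "closure G \<subseteq> \<Omega>" by (rule closure_subset_of_G_dist) fact
    have "continuous_on \<Omega> u" using assms by (simp add: quasiharmonic_def)
    then have "continuous_on (closure G) (\<lambda>y. ereal (u y))"
      using cl by (intro continuous_on_ereal) (rule continuous_on_subset)
    then have "(\<lambda>y. ereal (u y)) ` closure G \<subseteq> {..SUP x\<in>G. ereal (u x)}"
      by (rule image_closure_subset) (auto intro: SUP_upper)
    then show "ereal (u x) \<le> (SUP x\<in>G. ereal (u x))"
      using x by (auto simp: frontier_def)
  qed
qed

end
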